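(* Let $p\in\mathbb{N}$, $n\in\mathbb{N}_0$, $\mathbf{a},\mathbf{b}\in\mathbb{C}^p$ with $-\mathbf{a}\notin\mathbb{N}_0$, and $0<x<1$. Then $$ \widetilde{G}_n(x)-(-1)^n\widehat{G}_n(x)=\frac{(-x)^{n-1}\Gamma(\mathbf{a})}{(n-1)!\,\Gamma(\mathbf{b})}\;{}_{p+1}F_p\!\left(-n+1,\mathbf{a};\mathbf{b};\frac1x\right), $$ where for $n=0$ the right-hand side is understood to be $0$ (convention $1/(-1)!=0$).
   Context: $\mathbb{N}_0=\mathbb{N}\cup\{0\}$. For a vector $\mathbf{a}=(a_1,\dots,a_p)$: $\Gamma(\mathbf{a})=\prod_i\Gamma(a_i)$, $(\mathbf{a})_j=\prod_i(a_i)_j$, $\mathbf{a}+\mu=(a_1+\mu,\dots,a_p+\mu)$; conditions such as $-\mathbf{a}\notin\mathbb{N}_0$ are element-wise. For $0<t<1$, $$\widehat{G}_n(t)=G^{p,1}_{p+1,p+1}\!\left(t\,\Big|\begin{array}{l}n,\mathbf{b}+n-1\\ \mathbf{a}+n-1,0\end{array}\right)=\frac{1}{2\pi i}\int_{\mathcal{L}}\frac{\Gamma(\mathbf{a}+n-1+s)\,\Gamma(1-n-s)}{\Gamma(\mathbf{b}+n-1+s)\,\Gamma(1-s)}\,t^{-s}\,ds,$$ where $\mathcal{L}$ is a left loop (starting and ending at $-\infty$, traversed counterclockwise) that leaves all the points $1-a_j-n-l$, $l\in\mathbb{N}_0$, on its left and all the points $1-n+k$, $k\in\mathbb{N}_0$,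 on its right; and $$\widetilde{G}_n(t)=G^{p+1,0}_{p+1,p+1}\!\left(t\,\Big|\begin{array}{l}\mathbf{b}+n-1,n\\ \mathbf{a}+n-1,0\end{array}\right)=\frac{1}{2\pi i}\int_{\mathcal{L}'}\frac{\Gamma(\mathbf{a}+n-1+s)\,\Gamma(s)}{\Gamma(\mathbf{b}+n-1+s)\,\Gamma(n+s)}\,t^{-s}\,ds,$$ where $\mathcal{L}'$ is a left loop enclosing all poles of the integrand. The quotient $\frac{1}{\Gamma(\mathbf{b})}{}_{p+1}F_p(-n+1,\mathbf{a};\mathbf{b};y)$ is understood as the finite sum $\sum_{j=0}^{n-1}\frac{(1-n)_j(\mathbf{a})_j}{\Gamma(\mathbf{b}+j)\,j!}y^j$. *)

theory Defs
  imports "HOL-Complex_Analysis.Complex_Analysis"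
begin

text \<open>
  A left loop starts at \<open>-\<infinity> + i \<phi>\<^sub>1\<close>, ends at \<open>-\<infinity> + i \<phi>\<^sub>2\<close> with \<open>\<phi>\<^sub>1 < \<phi>\<^sub>2\<close>, and has horizontal
  ends. It is represented by its bounded part, a path \<open>g\<close> from a point of imaginary part \<open>\<phi>\<^sub>1\<close> to
  one of imaginary part \<open>\<phi>\<^sub>2\<close>; the full contour runs along the horizontal ray from \<open>-\<infinity> + i \<phi>\<^sub>1\<close> to
  \<^term>\<open>pathstart g\<close>, then along \<open>g\<close>, then along the horizontal ray from \<^term>\<open>pathfinish g\<close> to
  \<open>-\<infinity> + i \<phi>\<^sub>2\<close>. Self-intersections are not excluded.
\<close>

definition left_loop :: "(real \<Rightarrow> complex) \<Rightarrow> bool" where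
  "left_loop g \<longleftrightarrow> valid_path g \<and> Im (pathstart g) < Im (pathfinish g)"

definition left_loop_image :: "(real \<Rightarrow> complex) \<Rightarrow> complex set" where
  "left_loop_image g =
     {s. Im s = Im (pathstart g) \<and> Re s \<le> Re (pathstart g)} \<union> path_image g \<union>
     {s. Im s = Im (pathfinish g) \<and> Re s \<le> Re (pathfinish g)}"

text \<open>The loop cut off at real part \<open>T\<close> and closed by a vertical segment.\<close>

definition closed_left_loop :: "(real \<Rightarrow> complex) \<Rightarrow> real \<Rightarrow> real \<Rightarrow> complex" where
  "closed_left_loop g T =
     linepath (Complex T (Im (pathstart g))) (pathstart g) +++ g +++
     linepath (pathfinish g) (Complex T (Im (pathfinish g))) +++
     linepath (Complex T (Im (pathfinish g))) (Complex T (Im (pathstart g)))"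

text \<open>
  For a point off the loop, the winding number below does not depend on \<open>T\<close> once \<open>T\<close> is small
  enough. A counterclockwise simple left loop has winding number 1 around the points on its left
  (the enclosed ones) and 0 around those on its right.
\<close>

definition on_left_of_loop :: "(real \<Rightarrow> complex) \<Rightarrow> complex \<Rightarrow> bool" where
  "on_left_of_loop g z \<longleftrightarrow> z \<notin> left_loop_image g \<and>
     (\<forall>\<^sub>F T in at_bot. winding_number (closed_left_loop g T) z = 1)"

definition on_right_of_loop :: "(real \<Rightarrow> complex) \<Rightarrow> complex \<Rightarrow> bool" where
  "on_right_of_loop g z \<longleftrightarrow> z \<notin> left_loop_image g \<and>
     (\<forall>\<^sub>F T in at_bot. winding_number (closed_left_loop g T) z = 0)"

definition has_left_loop_integral ::
    "(complex \<Rightarrow> complex) \<Rightarrow> complex \<Rightarrow> (real \<Rightarrow> complex) \<Rightarrow> bool" where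
  "has_left_loop_integral f I g \<longleftrightarrow>
     (\<exists>I\<^sub>1 I\<^sub>2 I\<^sub>3.
        ((\<lambda>u. f (Complex u (Im (pathstart g)))) has_integral I\<^sub>1) {..Re (pathstart g)} \<and>
        (f has_contour_integral I\<^sub>2) g \<and>
        ((\<lambda>u. f (Complex u (Im (pathfinish g)))) has_integral I\<^sub>3) {..Re (pathfinish g)} \<and>
        I = I\<^sub>1 + I\<^sub>2 - I\<^sub>3)"

text \<open>
  Products over the components of a vector. Since \<^const>\<open>Gamma\<close> is 0 at its poles and division by
  0 yields 0, a quotient by \<open>Gamma_vec\<close> has the correct value 0 where a component is a pole.
\<close>

definition Gamma_vec :: "complex ^ 'p \<Rightarrow> complex" where
  "Gamma_vec a = (\<Prod>i\<in>UNIV. Gamma (a $ i))"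

definition pochhammer_vec :: "complex ^ 'p \<Rightarrow> nat \<Rightarrow> complex" where
  "pochhammer_vec a j = (\<Prod>i\<in>UNIV. pochhammer (a $ i) j)"

definition shift_vec :: "complex ^ 'p \<Rightarrow> complex \<Rightarrow> complex ^ 'p" where
  "shift_vec a \<mu> = (\<chi> i. a $ i + \<mu>)"

definition G_hat_integrand ::
    "complex ^ 'p \<Rightarrow> complex ^ 'p \<Rightarrow> nat \<Rightarrow> real \<Rightarrow> complex \<Rightarrow> complex" where
  "G_hat_integrand a b n t s =
     Gamma_vec (shift_vec a (of_nat n - 1 + s)) * Gamma (1 - of_nat n - s) /
     (Gamma_vec (shift_vec b (of_nat n - 1 + s)) * Gamma (1 - s)) *
     of_real t powr (- s)"

definition G_hat_loop :: "complex ^ 'p \<Rightarrow> nat \<Rightarrow> (real \<Rightarrow> complex) \<Rightarrow> bool" where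
  "G_hat_loop a n g \<longleftrightarrow> left_loop g \<and>
     (\<forall>j. \<forall>l::nat. on_left_of_loop g (1 - a $ j - of_nat n - of_nat l)) \<and>
     (\<forall>k::nat. on_right_of_loop g (1 - of_nat n + of_nat k))"

text \<open>
  The value is the one shared by all admissible loops; it is only specified if admissible loops
  exist and the integral converges to the same value along each of them.
\<close>

definition G_hat :: "complex ^ 'p \<Rightarrow> complex ^ 'p \<Rightarrow> nat \<Rightarrow> real \<Rightarrow> complex" where
  "G_hat a b n t = (THE G. \<forall>g. G_hat_loop a n g \<longrightarrow>
     has_left_loop_integral (G_hat_integrand a b n t) (2 * of_real pi * \<i> * G) g)"

definition G_tilde_integrand ::
    "complex ^ 'p \<Rightarrow> complex ^ 'p \<Rightarrow> nat \<Rightarrow> real \<Rightarrow> complex \<Rightarrow> complex" where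
  "G_tilde_integrand a b n t s =
     Gamma_vec (shift_vec a (of_nat n - 1 + s)) * Gamma s /
     (Gamma_vec (shift_vec b (of_nat n - 1 + s)) * Gamma (of_nat n + s)) *
     of_real t powr (- s)"

definition G_tilde_loop ::
    "complex ^ 'p \<Rightarrow> complex ^ 'p \<Rightarrow> nat \<Rightarrow> real \<Rightarrow> (real \<Rightarrow> complex) \<Rightarrow> bool" where
  "G_tilde_loop a b n t g \<longleftrightarrow> left_loop g \<and>
     (\<forall>z. is_pole (G_tilde_integrand a b n t) z \<longrightarrow> on_left_of_loop g z)"

definition G_tilde :: "complex ^ 'p \<Rightarrow> complex ^ 'p \<Rightarrow> nat \<Rightarrow> real \<Rightarrow> complex" where
  "G_tilde a b n t = (THE G. \<forall>g. G_tilde_loop a b n t g \<longrightarrow>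
     has_left_loop_integral (G_tilde_integrand a b n t) (2 * of_real pi * \<i> * G) g)"

text \<open>
  The quotient \<open>\<^sub>p\<^sub>+\<^sub>1F\<^sub>p(1 - n, a; b; y) / \<Gamma>(b)\<close>, a finite sum over \<open>j = 0, \<dots>, n - 1\<close>. Each
  \<open>\<Gamma>(b)\<close> has been absorbed into \<open>(b)\<^sub>j\<close>, so that components of \<open>b\<close> may be non-positive integers.
\<close>

definition hypergeometric_quotient ::
    "complex ^ 'p \<Rightarrow> complex ^ 'p \<Rightarrow> nat \<Rightarrow> complex \<Rightarrow> complex" where
  "hypergeometric_quotient a b n y =
     (\<Sum>j<n. pochhammer (1 - of_nat n) j * pochhammer_vec a j /
             (Gamma_vec (shift_vec b (of_nat j)) * fact j) * y ^ j)"

end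

theory Submission imports Defs begin

text \<open>
  Both integrands are, up to a sign, one and the same meromorphic function. By the functional
  equation, \<open>\<Gamma>(s) / \<Gamma>(n + s) = 1 / (s)\<^sub>n\<close> and \<open>\<Gamma>(1 - n - s) / \<Gamma>(1 - s) = (-1)\<^sup>n / (s)\<^sub>n\<close>, so that
  with \<open>K(s) = \<Gamma>(a + n - 1 + s) / \<Gamma>(b + n - 1 + s) \<sqdot> x\<^bsup>-s\<^esup> / (s)\<^sub>n\<close> the first integrand is \<open>K\<close> and
  the second one is \<open>(-1)\<^sup>n K\<close>. The two contours differ only in the zeros \<open>0, -1, \<dots>, 1 - n\<close> of
  \<open>(s)\<^sub>n\<close>: the loop of the first function encloses those that are poles of \<open>K\<close>, the loop of the
  second one leaves all of them outside, and both loops enclose the poles that stem from the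
  numerator. Hence the left-hand side is the sum of the residues of \<open>K\<close> at \<open>0, -1, \<dots>, 1 - n\<close>. These poles are at
  most simple because \<open>-a \<notin> \<nat>\<close> keeps the poles of the numerator away, and the residue at
  \<open>j + 1 - n\<close> is the term of index \<open>j\<close> of the finite hypergeometric sum.

  Convergence comes from the shift by 1. The quotient \<open>K(s - 1) / K(s)\<close> is a rational function that
  tends to \<open>x < 1\<close> as \<open>s \<rightarrow> \<infinity>\<close>, so \<open>K\<close> shrinks by a fixed factor with each
  unit step to the left as soon as \<open>Re s\<close> is small enough. The locale \<open>left_decaying\<close> axiomatises
  this. It makes the integrals along the rays converge and the integrals along vertical segments at
  \<open>T\<^sub>0 - k\<close> tend to 0, and the residue theorem for the loop cut off at \<open>T\<^sub>0 - k\<close> then gives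
  \<open>left_loop_integral_eq_residues\<close>: the integral depends only on which poles lie to the left of the
  loop.

  As the values of both functions are defined by a description over all admissible loops, two more
  things are required. Admissible loops must exist (\<open>exists_left_loop_separating\<close>), even when the
  poles to be enclosed and those to be left out interlace on the real axis. And a loop of the first
  function may run through removable singularities of its integrand, where the integrand has
  arbitrary values; \<open>has_left_loop_integral_spike_countable\<close> shows that these do not matter.
\<close>

section \<open>Integrals along left loops and countable exceptional sets\<close>

text \<open>
  A point where the derivative does not vanish is isolated in its fibre, so the fibre is locally a
  singleton among its regular points.
\<close>

lemma negligible_preimage_regular_points:
  fixes g :: "real \<Rightarrow> 'a::real_normed_vector"
  assumes "\<And>t. t \<in> E \<Longrightarrow> g t = z"
    and "\<And>t. t \<in> E \<Longrightarrow> (g has_vector_derivative v t) (at t)"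
    and "\<And>t. t \<in> E \<Longrightarrow> v t \<noteq> 0"
  shows "negligible E"
  unfolding locally_negligible_alt[of E]
proof
  fix t assume t: "t \<in> E"
  obtain d where d: "d > 0" and "\<And>y. 0 < norm (y - t) \<Longrightarrow> norm (y - t) < d \<Longrightarrow>
      norm (g y - g t - (y - t) *\<^sub>R v t) / norm (y - t) < norm (v t)"
    using assms(2)[OF t] assms(3)[OF t]
    unfolding has_vector_derivative_def has_derivative_at' by (metis zero_less_norm_iff)
  then have W: "g y \<noteq> g t" if "y \<noteq> t" "norm (y - t) < d" for y
    using that by fastforce
  define W where "W = ball t d"
  have "E \<inter> W = {t}"
    using W t assms(1) d by (force simp: W_def dist_norm norm_minus_commute)
  moreover have "open W"
    by (simp add: W_def)
  ultimately have "openin (top_of_set E) {t}"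
    by (metis openin_open)
  then show "\<exists>U. openin (top_of_set E) U \<and> t \<in> U \<and> negligible U"
    by (intro exI[of _ "{t}"]) auto
qed

text \<open>
  A path may spend a set of times of positive measure in a countable set, but its derivative
  vanishes at almost all of them.
\<close>

lemma has_contour_integral_spike_countable:
  assumes int: "(f has_contour_integral I) g" and "valid_path g" "countable D"
    and eq: "\<And>z. z \<notin> D \<Longrightarrow> h z = f z"
  shows "(h has_contour_integral I) g"
proof -
  obtain K v where K: "finite K"
    and v: "\<And>t. t \<in> {0..1} - K \<Longrightarrow> (g has_vector_derivative v t) (at t)"
    using \<open>valid_path g\<close> unfolding valid_path_def piecewise_C1_differentiable_on_def
      C1_differentiable_on_def by metis
  define E where "E z = {t \<in> {0..1} - K. g t = z \<and> v t \<noteq> 0}" for z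
  have "negligible (\<Union>(E ` D))"
    using \<open>countable D\<close>
    by (intro negligible_countable_Union)
       (auto simp: E_def intro!: negligible_preimage_regular_points v)
  then have neg: "negligible (K \<union> \<Union>(E ` D))"
    using K by (simp add: negligible_Un negligible_finite)
  show ?thesis
    unfolding has_contour_integral
  proof (rule has_integral_spike[OF neg])
    show "((\<lambda>t. f (g t) * vector_derivative g (at t)) has_integral I) {0..1}"
      using int by (simp add: has_contour_integral)
    fix t assume t: "t \<in> {0..1} - (K \<union> \<Union>(E ` D))"
    then have "vector_derivative g (at t) = v t"
      using v by (auto intro: vector_derivative_at)
    then show "h (g t) * vector_derivative g (at t) = f (g t) * vector_derivative g (at t)"
      using t eq[of "g t"] by (cases "g t \<in> D") (auto simp: E_def)
  qed
qed

lemma has_integral_ray_spike_countable: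
  assumes "((\<lambda>u. f (Complex u \<phi>)) has_integral I) {..U}" "countable D"
    and "\<And>z. z \<notin> D \<Longrightarrow> h z = f z"
  shows "((\<lambda>u. h (Complex u \<phi>)) has_integral I) {..U}"
proof (rule has_integral_spike)
  show "negligible (Re ` D)"
    using assms negligible_countable_Union[of "(\<lambda>z. {Re z}) ` D"]
    by (auto simp: UNION_singleton_eq_range)
  show "h (Complex u \<phi>) = f (Complex u \<phi>)" if "u \<in> {..U} - Re ` D" for u
  proof (rule assms(3))
    show "Complex u \<phi> \<notin> D"
      using that by (metis DiffD2 complex.sel(1) imageI)
  qed
qed (use assms in auto)

lemma has_left_loop_integralE:
  assumes "has_left_loop_integral f I g"
  obtains I1 I2 I3 where
    "((\<lambda>u. f (Complex u (Im (pathstart g)))) has_integral I1) {..Re (pathstart g)}"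
    "(f has_contour_integral I2) g"
    "((\<lambda>u. f (Complex u (Im (pathfinish g)))) has_integral I3) {..Re (pathfinish g)}"
    "I = I1 + I2 - I3"
  using assms unfolding has_left_loop_integral_def by blast

lemma has_left_loop_integralI:
  assumes "((\<lambda>u. f (Complex u (Im (pathstart g)))) has_integral I1) {..Re (pathstart g)}"
    and "(f has_contour_integral I2) g"
    and "((\<lambda>u. f (Complex u (Im (pathfinish g)))) has_integral I3) {..Re (pathfinish g)}"
    and "I = I1 + I2 - I3"
  shows "has_left_loop_integral f I g"
  unfolding has_left_loop_integral_def using assms by blast

lemma has_left_loop_integral_spike_countable:
  assumes "has_left_loop_integral f I g" and g: "valid_path g" and D: "countable D"
    and eq: "\<And>z. z \<notin> D \<Longrightarrow> h z = f z"
  shows "has_left_loop_integral h I g"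
  using assms(1)
proof (rule has_left_loop_integralE)
  fix I1 I2 I3
  assume I: "((\<lambda>u. f (Complex u (Im (pathstart g)))) has_integral I1) {..Re (pathstart g)}"
    "(f has_contour_integral I2) g"
    "((\<lambda>u. f (Complex u (Im (pathfinish g)))) has_integral I3) {..Re (pathfinish g)}"
    "I = I1 + I2 - I3"
  show ?thesis
    by (rule has_left_loop_integralI[OF has_integral_ray_spike_countable[OF I(1) D eq]
          has_contour_integral_spike_countable[OF I(2) g D eq]
          has_integral_ray_spike_countable[OF I(3) D eq] I(4)])
qed

lemma has_left_loop_integral_unique:
  assumes "has_left_loop_integral f I g" "has_left_loop_integral f J g"
  shows "I = J"
  using assms(1)
proof (rule has_left_loop_integralE)
  fix I1 I2 I3
  assume I: "((\<lambda>u. f (Complex u (Im (pathstart g)))) has_integral I1) {..Re (pathstart g)}"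
    "(f has_contour_integral I2) g"
    "((\<lambda>u. f (Complex u (Im (pathfinish g)))) has_integral I3) {..Re (pathfinish g)}"
    "I = I1 + I2 - I3"
  show ?thesis
    using assms(2)
  proof (rule has_left_loop_integralE)
    fix J1 J2 J3
    assume J: "((\<lambda>u. f (Complex u (Im (pathstart g)))) has_integral J1) {..Re (pathstart g)}"
      "(f has_contour_integral J2) g"
      "((\<lambda>u. f (Complex u (Im (pathfinish g)))) has_integral J3) {..Re (pathfinish g)}"
      "J = J1 + J2 - J3"
    show "I = J"
      using has_integral_unique[OF I(1) J(1)] has_contour_integral_unique[OF I(2) J(2)]
        has_integral_unique[OF I(3) J(3)] I(4) J(4) by simp
  qed
qed

lemma has_left_loop_integral_cmult:
  assumes "has_left_loop_integral f I g"
  shows "has_left_loop_integral (\<lambda>s. c * f s) (c * I) g"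
  using assms
proof (rule has_left_loop_integralE)
  fix I1 I2 I3
  assume I: "((\<lambda>u. f (Complex u (Im (pathstart g)))) has_integral I1) {..Re (pathstart g)}"
    "(f has_contour_integral I2) g"
    "((\<lambda>u. f (Complex u (Im (pathfinish g)))) has_integral I3) {..Re (pathfinish g)}"
    "I = I1 + I2 - I3"
  have "c * I = c * I1 + c * I2 - c * I3"
    by (simp add: I(4) ring_distribs)
  then show ?thesis
    by (rule has_left_loop_integralI[OF has_integral_mult_right[OF I(1)]
          has_contour_integral_lmul[OF I(2)] has_integral_mult_right[OF I(3)]])
qed

text \<open>
  How a value described by all admissible loops is computed: one loop makes it unique, and all
  loops together make it correct.
\<close>

lemma common_loop_integral_value:
  assumes "\<exists>g. Q g" and "\<And>g. Q g \<Longrightarrow> has_left_loop_integral f I g"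
  shows "(THE G. \<forall>g. Q g \<longrightarrow> has_left_loop_integral f (2 * of_real pi * \<i> * G) g) = I / (2 * of_real pi * \<i>)"
proof (rule the_equality)
  show "\<forall>g. Q g \<longrightarrow> has_left_loop_integral f (2 * of_real pi * \<i> * (I / (2 * of_real pi * \<i>))) g"
    using assms(2) by simp
  fix G assume G: "\<forall>g. Q g \<longrightarrow> has_left_loop_integral f (2 * of_real pi * \<i> * G) g"
  obtain g where "Q g"
    using assms(1) by blast
  then have "2 * of_real pi * \<i> * G = I"
    using has_left_loop_integral_unique[OF G[rule_format] assms(2)] by blast
  then show "G = I / (2 * of_real pi * \<i>)"
    by (simp add: field_simps)
qed

section \<open>Functions that decay geometrically to the left\<close>

lemma sparse_in_UNIV_if_finite_right:
  assumes "\<And>T. finite {z \<in> A. T \<le> Re z}"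
  shows "A sparse_in UNIV"
proof -
  have "\<not> z islimpt A" for z
  proof
    assume "z islimpt A"
    then have "infinite (A \<inter> ball z 1)"
      by (simp add: islimpt_eq_infinite_ball)
    moreover have "A \<inter> ball z 1 \<subseteq> {w \<in> A. Re z - 1 \<le> Re w}"
      by (auto simp: dist_norm dest!: order.strict_trans1[OF abs_Re_le_cmod])
    ultimately show False
      using assms finite_subset by blast
  qed
  then show ?thesis
    by (simp add: sparse_in_open)
qed

lemma integrable_on_exp_left_ray:
  fixes c U :: real
  assumes "c > 0"
  shows "(\<lambda>u. exp (c * u)) integrable_on {..U}"
proof -
  define f where "f k u = (if u \<in> {U - real k..U} then exp (c * u) else 0)" for k u
  have 1: "((\<lambda>u. exp (c * u)) has_integral (exp (c * U) / c - exp (c * (U - real k)) / c))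
      {U - real k..U}" for k
    using assms
    by (intro fundamental_theorem_of_calculus)
       (auto intro!: derivative_eq_intros simp flip: has_real_derivative_iff_has_vector_derivative)
  have 2: "(f k has_integral (exp (c * U) / c - exp (c * (U - real k)) / c)) {..U}" for k
    unfolding f_def by (subst has_integral_restrict) (use 1 in auto)
  have "(\<lambda>u. exp (c * u)) integrable_on {..U} \<and>
      (\<lambda>k. integral {..U} (f k)) \<longlonglongrightarrow> integral {..U} (\<lambda>u. exp (c * u))"
  proof (rule monotone_convergence_increasing)
    show "f k integrable_on {..U}" for k
      using 2 by blast
    show "f k u \<le> f (Suc k) u" for k u
      by (auto simp: f_def)
    show "(\<lambda>k. f k u) \<longlonglongrightarrow> exp (c * u)" if "u \<in> {..U}" for u
    proof (rule tendsto_eventually)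
      have "\<forall>\<^sub>F k in sequentially. U - u \<le> real k"
        by real_asymp
      then show "\<forall>\<^sub>F k in sequentially. f k u = exp (c * u)"
        by eventually_elim (use that in \<open>auto simp: f_def\<close>)
    qed
    have "norm (integral {..U} (f k)) \<le> exp (c * U) / c" for k
    proof -
      have "exp (c * (U - real k)) \<le> exp (c * U)"
        using assms by (simp add: mult_left_mono)
      then have "0 \<le> exp (c * U) / c - exp (c * (U - real k)) / c"
        using assms by (simp add: divide_right_mono)
      then show ?thesis
        using integral_unique[OF 2[of k]] assms by simp
    qed
    then show "bounded (range (\<lambda>k. integral {..U} (f k)))"
      by (auto simp: bounded_iff)
  qed
  then show ?thesis
    by blast
qed

text \<open>
  A function with singularities in \<open>S\<close> that shrinks by the factor \<open>r\<close> with each unit step to the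
  left of \<open>M\<close>. Only finitely many singularities lie to the right of any vertical line, but there may
  be infinitely many on the left.
\<close>

locale left_decaying =
  fixes F :: "complex \<Rightarrow> complex" and S :: "complex set" and r M :: real
  assumes ratio: "0 < r" "r < 1"
    and holo: "F holomorphic_on - S"
    and finite_right: "finite {z \<in> S. Re z \<ge> T}"
    and step: "Re s \<le> M \<Longrightarrow> s \<notin> S \<Longrightarrow> s - 1 \<notin> S \<Longrightarrow> norm (F (s - 1)) \<le> r * norm (F s)"
begin

lemma sparse_S: "S sparse_in UNIV"
  by (rule sparse_in_UNIV_if_finite_right[OF finite_right])

lemma open_compl_S: "open (- S)"
  using sparse_in_UNIV_imp_closed[OF sparse_S] by (simp add: open_Compl)

lemma contour_integrable:
  assumes "valid_path g" "path_image g \<inter> S = {}"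
  shows "F contour_integrable_on g"
  using contour_integrable_holomorphic_simple[OF holo open_compl_S] assms by blast

text \<open>
  The intermediate points have to avoid \<open>S\<close> as well, since nothing is known about a step that starts
  or ends at a singularity.
\<close>

lemma norm_shift_left_le:
  assumes "Re s \<le> M" "\<And>j. j \<le> k \<Longrightarrow> s - of_nat j \<notin> S"
  shows "norm (F (s - of_nat k)) \<le> r ^ k * norm (F s)"
  using assms(2)
proof (induction k)
  case (Suc k)
  have "norm (F (s - of_nat k - 1)) \<le> r * norm (F (s - of_nat k))"
    using Suc.prems[of k] Suc.prems[of "Suc k"] assms(1) by (intro step) (auto simp: algebra_simps)
  also have "\<dots> \<le> r * (r ^ k * norm (F s))"
    using ratio Suc by (intro mult_left_mono) auto
  finally show ?case
    by (simp add: algebra_simps)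
qed simp

text \<open>
  By the unit steps, the maximum of \<open>|F| r\<^bsup>u\<^esup>\<close> on one interval of length 1 (and on the compact rest of
  the ray) bounds it everywhere.
\<close>

lemma bound_on_ray:
  assumes "\<And>u. u \<le> U \<Longrightarrow> Complex u \<phi> \<notin> S"
  obtains B where "\<And>u. u \<le> U \<Longrightarrow> norm (F (Complex u \<phi>)) \<le> B * exp (- ln r * u)"
proof -
  define f where "f u = F (Complex u \<phi>) * exp (of_real (ln r * u))" for u
  \<comment> \<open>the steps are available to the left of \<open>M\<close> only\<close>
  define V where "V = min U M"
  have cont: "continuous_on {V - 1..U} f"
    unfolding f_def
    by (intro continuous_intros continuous_on_compose2[OF holomorphic_on_imp_continuous_on[OF holo]])
       (use assms in \<open>auto simp: Complex_eq intro!: continuous_intros\<close>)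
  then have "bounded (f ` {V - 1..U})"
    by (intro compact_imp_bounded compact_continuous_image) auto
  then obtain B where B: "\<And>u. u \<in> {V - 1..U} \<Longrightarrow> norm (f u) \<le> B"
    unfolding bounded_iff by (metis imageI)
  have norm_f: "norm (f u) = norm (F (Complex u \<phi>)) * exp (ln r * u)" for u
    by (simp add: f_def norm_mult)
  have "norm (f u) \<le> B" if "u \<le> U" for u
  proof (cases "u \<ge> V - 1")
    case False
    define k where "k = nat \<lfloor>V - u\<rfloor>"
    have k: "real k \<le> V - u" "V - u < real k + 1"
      using False by (auto simp: k_def)
    have "norm (F (Complex (u + real k) \<phi> - of_nat k)) \<le> r ^ k * norm (F (Complex (u + real k) \<phi>))"
    proof (rule norm_shift_left_le)
      fix j assume "j \<le> k"
      have "Complex (u + real k) \<phi> - of_nat j = Complex (u + real k - real j) \<phi>"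
        by (simp add: complex_eq_iff)
      then show "Complex (u + real k) \<phi> - of_nat j \<notin> S"
        using assms[of "u + real k - real j"] k by (auto simp: V_def)
    qed (use k in \<open>auto simp: V_def\<close>)
    moreover have "Complex (u + real k) \<phi> - of_nat k = Complex u \<phi>"
      by (simp add: complex_eq_iff)
    moreover have "exp (ln r * (u + real k)) = exp (ln r * u) * r ^ k"
      using ratio by (simp add: ring_distribs exp_add exp_of_nat2_mult)
    ultimately have "norm (f u) \<le> norm (f (u + real k))"
      by (simp add: norm_f mult_right_mono mult_ac)
    also have "\<dots> \<le> B"
      using k by (intro B) (auto simp: V_def)
    finally show ?thesis .
  qed (use B that in auto)
  then have "norm (F (Complex u \<phi>)) \<le> B * exp (- ln r * u)" if "u \<le> U" for u
    using that by (simp add: norm_f exp_minus field_simps)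
  then show thesis
    using that by blast
qed

lemma ray_integral:
  assumes avoid: "\<And>u. u \<le> U \<Longrightarrow> Complex u \<phi> \<notin> S"
  obtains I where "((\<lambda>u. F (Complex u \<phi>)) has_integral I) {..U}"
    and "(\<lambda>k. contour_integral (linepath (Complex (T0 - real k) \<phi>) (Complex U \<phi>)) F) \<longlonglongrightarrow> I"
proof -
  define f where "f u = F (Complex u \<phi>)" for u
  define f' where "f' k u = (if u \<in> {T0 - real k..U} then f u else 0)" for k u
  from bound_on_ray[OF avoid] obtain B
    where B: "\<And>u. u \<le> U \<Longrightarrow> norm (f u) \<le> B * exp (- ln r * u)"
    unfolding f_def by blast
  have cont: "continuous_on {T..U} f" for T
    unfolding f_def
    by (intro continuous_on_compose2[OF holomorphic_on_imp_continuous_on[OF holo]])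
       (use avoid in \<open>auto simp: Complex_eq intro!: continuous_intros\<close>)
  have Int: "{T..U} \<inter> {..U} = {T..U}" for T
    by auto
  have int: "f' k integrable_on {..U}" for k
    unfolding f'_def integrable_restrict_Int Int by (intro integrable_continuous_interval cont)
  have exp: "(\<lambda>u. B * exp (- ln r * u)) integrable_on {..U}"
    using ratio by (intro integrable_on_mult_right integrable_on_exp_left_ray) auto
  have le: "norm (f' k u) \<le> B * exp (- ln r * u)" if "u \<in> {..U}" for k u
  proof -
    have "norm (f' k u) \<le> norm (f u)"
      by (simp add: f'_def)
    then show ?thesis
      using B[of u] that by auto
  qed
  have lim: "(\<lambda>k. f' k u) \<longlonglongrightarrow> f u" if "u \<in> {..U}" for u
  proof (rule tendsto_eventually)
    have "\<forall>\<^sub>F k in sequentially. T0 - u \<le> real k"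
      by real_asymp
    then show "\<forall>\<^sub>F k in sequentially. f' k u = f u"
      by eventually_elim (use that in \<open>auto simp: f'_def\<close>)
  qed
  note dom = dominated_convergence[of f', OF int exp le lim]
  have "(f has_integral integral {..U} f) {..U}"
    using dom(1) by (simp add: has_integral_integral)
  moreover have "(\<lambda>k. contour_integral (linepath (Complex (T0 - real k) \<phi>) (Complex U \<phi>)) F)
      \<longlonglongrightarrow> integral {..U} f"
  proof (rule Lim_transform_eventually[OF dom(2)])
    have "\<forall>\<^sub>F k in sequentially. T0 - real k < U"
      by real_asymp
    then show "\<forall>\<^sub>F k in sequentially. integral {..U} (f' k) =
        contour_integral (linepath (Complex (T0 - real k) \<phi>) (Complex U \<phi>)) F"
    proof eventually_elim
      case (elim k)
      have "linepath (Complex (T0 - real k) \<phi>) (Complex U \<phi>) =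
          (+) (Complex 0 \<phi>) \<circ> linepath (of_real (T0 - real k)) (of_real U)"
        by (auto simp: linepath_def complex_eq_iff algebra_simps fun_eq_iff)
      then have "contour_integral (linepath (Complex (T0 - real k) \<phi>) (Complex U \<phi>)) F =
          contour_integral (linepath (of_real (T0 - real k)) (of_real U)) (\<lambda>z. F (z + Complex 0 \<phi>))"
        by (simp only: contour_integral_translate)
      also have "\<dots> = integral {T0 - real k..U} (\<lambda>u. F (of_real u + Complex 0 \<phi>))"
        using elim by (subst contour_integral_linepath_Reals_eq) auto
      also have "(\<lambda>u. F (of_real u + Complex 0 \<phi>)) = f"
        unfolding f_def by (intro ext arg_cong[of _ _ F]) (simp add: complex_eq_iff)
      also have "integral {T0 - real k..U} f = integral {..U} (f' k)"
        using integral_restrict_Int[of "{..U}" "{T0 - real k..U}" f] unfolding Int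
        by (simp add: f'_def[abs_def] del: integral_restrict_Int)
      finally show ?case ..
    qed
  qed
  ultimately show thesis
    using that unfolding f_def by blast
qed

text \<open>
  The segments are translates of one another by integers, so the bound on the first one shrinks
  geometrically.
\<close>

lemma vertical_integral_tendsto_0:
  assumes "T0 \<le> M" and avoid: "\<And>k z. z \<in> S \<Longrightarrow> Re z \<noteq> T0 - real k"
  shows "(\<lambda>k. contour_integral (linepath (Complex (T0 - real k) \<beta>) (Complex (T0 - real k) \<alpha>)) F)
    \<longlonglongrightarrow> 0"
proof -
  define L where "L k = closed_segment (Complex (T0 - real k) \<beta>) (Complex (T0 - real k) \<alpha>)" for k
  have Re_L: "Re z = T0 - real k" if "z \<in> L k" for z k
    using that by (auto simp: L_def closed_segment_same_Re)
  then have L: "L k \<subseteq> - S" for k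
    using avoid by blast
  have "compact (L 0)"
    by (simp add: L_def)
  then have "bounded (F ` L 0)"
    using L[of 0] holomorphic_on_imp_continuous_on[OF holo]
    by (intro compact_imp_bounded compact_continuous_image) (auto intro: continuous_on_subset)
  then obtain B where "B > 0" and B: "\<And>z. z \<in> L 0 \<Longrightarrow> norm (F z) \<le> B"
    unfolding bounded_pos by (metis imageI)
  have bound: "norm (F z) \<le> r ^ k * B" if "z \<in> L k" for z k
  proof -
    have Im: "Im z \<in> closed_segment \<beta> \<alpha>" and z: "Re z = T0 - real k"
      using that by (auto simp: L_def closed_segment_same_Re)
    have 0: "z + of_nat k \<in> L 0"
      using Im z by (auto simp: L_def closed_segment_same_Re)
    have "norm (F (z + of_nat k - of_nat k)) \<le> r ^ k * norm (F (z + of_nat k))"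
    proof (rule norm_shift_left_le)
      fix j assume "j \<le> k"
      have "Re (z + of_nat k - of_nat j) = T0 - real j"
        using z by simp
      then show "z + of_nat k - of_nat j \<notin> S"
        using avoid by blast
    qed (use z \<open>T0 \<le> M\<close> in auto)
    also have "\<dots> \<le> r ^ k * B"
      using B[OF 0] ratio by (intro mult_left_mono) auto
    finally show ?thesis
      by simp
  qed
  have "norm (contour_integral (linepath (Complex (T0 - real k) \<beta>) (Complex (T0 - real k) \<alpha>)) F)
      \<le> r ^ k * B * \<bar>\<beta> - \<alpha>\<bar>" for k
  proof -
    have "norm (contour_integral (linepath (Complex (T0 - real k) \<beta>) (Complex (T0 - real k) \<alpha>)) F)
      \<le> r ^ k * B * norm (Complex (T0 - real k) \<alpha> - Complex (T0 - real k) \<beta>)"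
      using bound[of _ k] L[of k] ratio \<open>B > 0\<close>
      by (intro contour_integral_bound_linepath contour_integrable) (auto simp: L_def)
    also have "norm (Complex (T0 - real k) \<alpha> - Complex (T0 - real k) \<beta>) = \<bar>\<beta> - \<alpha>\<bar>"
      by (simp add: cmod_def)
    finally show ?thesis .
  qed
  moreover have "(\<lambda>k. r ^ k * B * \<bar>\<beta> - \<alpha>\<bar>) \<longlonglongrightarrow> 0"
    using ratio by (intro tendsto_mult_left_zero LIMSEQ_realpow_zero) auto
  ultimately show ?thesis
    by (rule Lim_null_comparison[OF always_eventually[OF allI]])
qed

end

section \<open>Winding numbers of left loops cut off on the left\<close>

lemma left_loop_imageI:
  "z \<in> path_image g \<Longrightarrow> z \<in> left_loop_image g"
  "u \<le> Re (pathstart g) \<Longrightarrow> Complex u (Im (pathstart g)) \<in> left_loop_image g"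
  "u \<le> Re (pathfinish g) \<Longrightarrow> Complex u (Im (pathfinish g)) \<in> left_loop_image g"
  by (auto simp: left_loop_image_def)

lemma
  shows pathstart_closed_left_loop [simp]:
      "pathstart (closed_left_loop g T) = Complex T (Im (pathstart g))"
    and pathfinish_closed_left_loop [simp]:
      "pathfinish (closed_left_loop g T) = Complex T (Im (pathstart g))"
  by (simp_all add: closed_left_loop_def)

lemma valid_path_closed_left_loop [simp]:
  "valid_path g \<Longrightarrow> valid_path (closed_left_loop g T)"
  by (simp add: closed_left_loop_def)

lemma closed_segment_left_ray:
  assumes "T \<le> Re z"
  shows "closed_segment (Complex T (Im z)) z = {w. Im w = Im z \<and> T \<le> Re w \<and> Re w \<le> Re z}"
  using assms by (auto simp: closed_segment_same_Im closed_segment_eq_real_ivl)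

context
  fixes g :: "real \<Rightarrow> complex" and T :: real
  assumes T: "T \<le> Re (pathstart g)" "T \<le> Re (pathfinish g)"
begin

lemma rays_subset_left_loop_image:
  "closed_segment (Complex T (Im (pathstart g))) (pathstart g) \<subseteq> left_loop_image g"
  "closed_segment (pathfinish g) (Complex T (Im (pathfinish g))) \<subseteq> left_loop_image g"
  using T by (auto simp: closed_segment_left_ray left_loop_image_def
      closed_segment_commute[of "pathfinish g"])

lemma path_image_closed_left_loop:
  assumes "z \<in> path_image (closed_left_loop g T)"
  shows "z \<in> left_loop_image g \<or> Re z = T"
  using assms rays_subset_left_loop_image
  unfolding closed_left_loop_def
  by (auto simp: path_image_join closed_segment_same_Re intro: left_loop_imageI(1))

lemma winding_number_closed_left_loop:
  assumes "path g" "z \<notin> left_loop_image g" "Re z \<noteq> T"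
  shows "winding_number (closed_left_loop g T) z =
    winding_number (linepath (Complex T (Im (pathstart g))) (pathstart g)) z +
    winding_number g z +
    winding_number (linepath (pathfinish g) (Complex T (Im (pathfinish g)))) z +
    winding_number (linepath (Complex T (Im (pathfinish g))) (Complex T (Im (pathstart g)))) z"
proof -
  have 1: "z \<notin> closed_segment (Complex T (Im (pathstart g))) (pathstart g)"
    "z \<notin> closed_segment (pathfinish g) (Complex T (Im (pathfinish g)))"
    using rays_subset_left_loop_image assms by auto
  have 2: "z \<notin> closed_segment (Complex T (Im (pathfinish g))) (Complex T (Im (pathstart g)))"
    using assms by (auto simp: closed_segment_same_Re)
  have 3: "z \<notin> path_image g"
    using assms left_loop_imageI(1) by blast
  show ?thesis
    unfolding closed_left_loop_def using 1 2 3 \<open>path g\<close>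
    by (simp add: winding_number_join not_in_path_image_join)
qed

end

text \<open>
  The rectangle with the sides \<open>Re w = T'\<close> and \<open>Re w = T\<close> does not wind around points to the right
  of it. This is what changes when the cut of a left loop moves from \<open>T\<close> to \<open>T'\<close>.
\<close>

lemma winding_number_rectangle_left:
  assumes "T' \<le> T" "T < Re z"
  shows "winding_number (linepath (Complex T' \<alpha>) (Complex T \<alpha>)) z +
      winding_number (linepath (Complex T \<beta>) (Complex T' \<beta>)) z +
      winding_number (linepath (Complex T' \<beta>) (Complex T' \<alpha>)) z =
    winding_number (linepath (Complex T \<beta>) (Complex T \<alpha>)) z"
proof -
  define R where "R = linepath (Complex T' \<alpha>) (Complex T \<alpha>) +++
    linepath (Complex T \<alpha>) (Complex T \<beta>) +++ linepath (Complex T \<beta>) (Complex T' \<beta>) +++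
    linepath (Complex T' \<beta>) (Complex T' \<alpha>)"
  have conv: "convex {w. Re w \<le> T}"
    by (rule convex_halfspace_Re_le)
  have seg: "closed_segment v w \<subseteq> {w. Re w \<le> T}" if "Re v \<le> T" "Re w \<le> T" for v w
    using that by (intro closed_segment_subset conv) auto
  have z: "z \<notin> closed_segment v w" if "Re v \<le> T" "Re w \<le> T" for v w
    using seg[OF that] assms by auto
  have "winding_number R z = 0"
    using assms seg unfolding R_def
    by (intro winding_number_zero_outside[OF _ conv]) (auto simp: path_image_join)
  moreover have "winding_number R z = winding_number (linepath (Complex T' \<alpha>) (Complex T \<alpha>)) z +
      (winding_number (linepath (Complex T \<alpha>) (Complex T \<beta>)) z +
      (winding_number (linepath (Complex T \<beta>) (Complex T' \<beta>)) z +
      winding_number (linepath (Complex T' \<beta>) (Complex T' \<alpha>)) z))"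
    using assms z unfolding R_def
    by (simp add: winding_number_join not_in_path_image_join)
  moreover have "winding_number (linepath (Complex T \<alpha>) (Complex T \<beta>)) z =
      - winding_number (linepath (Complex T \<beta>) (Complex T \<alpha>)) z"
    using winding_number_reversepath[of "linepath (Complex T \<beta>) (Complex T \<alpha>)" z]
      z[of "Complex T \<beta>" "Complex T \<alpha>"] by simp
  ultimately show ?thesis
    by (simp add: algebra_simps add_eq_0_iff)
qed

lemma winding_number_closed_left_loop_cong:
  assumes g: "path g" and z: "z \<notin> left_loop_image g"
    and T: "T \<le> Re (pathstart g)" "T \<le> Re (pathfinish g)" "T < Re z" and "T' \<le> T"
  shows "winding_number (closed_left_loop g T') z = winding_number (closed_left_loop g T) z"
proof -
  define s f where "s = pathstart g" and "f = pathfinish g"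
  have T': "T' \<le> Re (pathstart g)" "T' \<le> Re (pathfinish g)"
    using T \<open>T' \<le> T\<close> by auto
  note sub = rays_subset_left_loop_image[OF T']
  have 1: "winding_number (linepath (Complex T' (Im s)) s) z =
      winding_number (linepath (Complex T' (Im s)) (Complex T (Im s))) z +
      winding_number (linepath (Complex T (Im s)) s) z"
    using sub z T \<open>T' \<le> T\<close> by (intro winding_number_split_linepath) (auto simp: s_def closed_segment_left_ray)
  have 2: "winding_number (linepath f (Complex T' (Im f))) z =
      winding_number (linepath f (Complex T (Im f))) z +
      winding_number (linepath (Complex T (Im f)) (Complex T' (Im f))) z"
    using sub z T \<open>T' \<le> T\<close>
    by (intro winding_number_split_linepath)
       (auto simp: f_def closed_segment_left_ray closed_segment_commute[of "pathfinish g"])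
  show ?thesis
    using winding_number_closed_left_loop[OF T(1,2) g z]
      winding_number_closed_left_loop[OF T' g z] T(3) \<open>T' \<le> T\<close> 1 2
      winding_number_rectangle_left[OF \<open>T' \<le> T\<close> T(3), of "Im s" "Im f"]
    unfolding s_def[symmetric] f_def[symmetric]
    by (simp add: algebra_simps)
qed

text \<open>
  Makes the limit in the definition of the two sides of a loop effective: the winding number has its
  final value as soon as the cut lies to the left of the point and of the ends of the bounded part.
\<close>

lemma winding_number_closed_left_loop_eventually:
  assumes ev: "\<forall>\<^sub>F T in at_bot. winding_number (closed_left_loop g T) z = w"
    and "path g" "z \<notin> left_loop_image g"
    and T: "T \<le> Re (pathstart g)" "T \<le> Re (pathfinish g)" "T < Re z"
  shows "winding_number (closed_left_loop g T) z = w"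
proof -
  obtain T1 where "\<And>T. T \<le> T1 \<Longrightarrow> winding_number (closed_left_loop g T) z = w"
    using ev by (auto simp: eventually_at_bot_linorder)
  then show ?thesis
    using winding_number_closed_left_loop_cong[OF assms(2,3) T, of "min T T1"] by simp
qed

lemma winding_number_closed_left_loop_outside:
  assumes "path g" and "\<And>w. w \<in> path_image g \<Longrightarrow> T \<le> Re w" "Re z < T"
  shows "winding_number (closed_left_loop g T) z = 0"
proof (rule winding_number_zero_outside)
  show "path (closed_left_loop g T)"
    using \<open>path g\<close> by (simp add: closed_left_loop_def)
  show "convex {w. T \<le> Re w}"
    by (rule convex_halfspace_Re_ge)
  have ends: "T \<le> Re (pathstart g)" "T \<le> Re (pathfinish g)"
    using assms by auto
  have seg: "closed_segment v w \<subseteq> {w. T \<le> Re w}" if "T \<le> Re v" "T \<le> Re w" for v w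
    using that by (intro closed_segment_subset convex_halfspace_Re_ge) auto
  have "path_image g \<subseteq> {w. T \<le> Re w}"
    using assms(2) by auto
  then show "path_image (closed_left_loop g T) \<subseteq> {w. T \<le> Re w}"
    unfolding closed_left_loop_def by (simp add: path_image_join seg ends)
qed (use assms in auto)

section \<open>Left loop integrals as residue series\<close>

context left_decaying
begin

text \<open>
  The residue theorem for the loop cut off at \<open>T\<^sub>0 - k\<close>, in the limit \<open>k \<rightarrow> \<infinity>\<close>. The sequence of
  partial sums is the same for all loops with the same set \<open>L\<close>, hence so is the integral. Its
  convergence is part of the conclusion.
\<close>

theorem left_loop_integral_eq_residues:
  assumes g: "left_loop g" and avoid_g: "left_loop_image g \<inter> S = {}"
    and T0: "T0 \<le> M" "\<And>k z. z \<in> S \<Longrightarrow> Re z \<noteq> T0 - real k"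
    and left: "\<And>z. z \<in> S \<Longrightarrow> z \<in> L \<Longrightarrow> on_left_of_loop g z"
    and right: "\<And>z. z \<in> S \<Longrightarrow> z \<notin> L \<Longrightarrow> on_right_of_loop g z"
  obtains I where "has_left_loop_integral F I g"
    and "(\<lambda>k. 2 * of_real pi * \<i> * (\<Sum>p | p \<in> S \<inter> L \<and> T0 - real k < Re p. residue F p)) \<longlonglongrightarrow> I"
proof -
  have valid: "valid_path g" and path: "path g"
    using g by (auto simp: left_loop_def valid_path_imp_path)
  define s f where "s = pathstart g" and "f = pathfinish g"
  define T where "T k = T0 - real k" for k
  have avoid_ray: "Complex u (Im s) \<notin> S" if "u \<le> Re s" for u
    using left_loop_imageI(2)[of u g] that avoid_g by (auto simp: s_def)
  have avoid_ray': "Complex u (Im f) \<notin> S" if "u \<le> Re f" for u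
    using left_loop_imageI(3)[of u g] that avoid_g by (auto simp: f_def)
  obtain I1 where I1: "((\<lambda>u. F (Complex u (Im s))) has_integral I1) {..Re s}"
    "(\<lambda>k. contour_integral (linepath (Complex (T k) (Im s)) (Complex (Re s) (Im s))) F) \<longlonglongrightarrow> I1"
    using ray_integral[of "Re s" "Im s" T0, folded T_def] avoid_ray by blast
  obtain I3 where I3: "((\<lambda>u. F (Complex u (Im f))) has_integral I3) {..Re f}"
    "(\<lambda>k. contour_integral (linepath (Complex (T k) (Im f)) (Complex (Re f) (Im f))) F) \<longlonglongrightarrow> I3"
    using ray_integral[of "Re f" "Im f" T0, folded T_def] avoid_ray' by blast
  note I1 = I1[unfolded complex_surj] and I3 = I3[unfolded complex_surj]
  define I2 where "I2 = contour_integral g F"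
  have disj_g: "path_image g \<inter> S = {}"
    using avoid_g left_loop_imageI(1) by blast
  then have I2: "(F has_contour_integral I2) g"
    unfolding I2_def using contour_integrable[OF valid] has_contour_integral_integral by blast
  have vert: "(\<lambda>k. contour_integral (linepath (Complex (T k) (Im f)) (Complex (T k) (Im s))) F) \<longlonglongrightarrow> 0"
    unfolding T_def by (rule vertical_integral_tendsto_0) (use T0 in auto)
  have has: "has_left_loop_integral F (I1 + I2 - I3) g"
    by (rule has_left_loop_integralI[OF _ I2]) (use I1 I3 in \<open>auto simp: s_def f_def\<close>)
  have lim: "(\<lambda>k. 2 * of_real pi * \<i> * (\<Sum>p | p \<in> S \<inter> L \<and> T k < Re p. residue F p))
      \<longlonglongrightarrow> I1 + I2 - I3"
  proof (rule Lim_transform_eventually)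
    show "(\<lambda>k. contour_integral (linepath (Complex (T k) (Im s)) s) F + I2
        - contour_integral (linepath (Complex (T k) (Im f)) f) F
        + contour_integral (linepath (Complex (T k) (Im f)) (Complex (T k) (Im s))) F)
      \<longlonglongrightarrow> I1 + I2 - I3"
      using tendsto_add[OF tendsto_diff[OF tendsto_add[OF I1(2) tendsto_const[of I2]] I3(2)] vert]
      by simp
    obtain b where b: "\<And>w. w \<in> path_image g \<Longrightarrow> norm w \<le> b"
      using bounded_path_image[OF path] by (auto simp: bounded_iff)
    have "\<forall>\<^sub>F k in sequentially. T k < - b"
      unfolding T_def by real_asymp
    then show "\<forall>\<^sub>F k in sequentially. contour_integral (linepath (Complex (T k) (Im s)) s) F + I2
        - contour_integral (linepath (Complex (T k) (Im f)) f) F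
        + contour_integral (linepath (Complex (T k) (Im f)) (Complex (T k) (Im s))) F =
      2 * of_real pi * \<i> * (\<Sum>p | p \<in> S \<inter> L \<and> T k < Re p. residue F p)"
    proof eventually_elim
      case (elim k)
      have Re_g: "T k < Re w" if "w \<in> path_image g" for w
        using b[OF that] elim abs_Re_le_cmod[of w] by linarith
      have Ts: "T k \<le> Re s" "T k \<le> Re f"
        unfolding s_def f_def
        by (rule less_imp_le[OF Re_g], rule pathstart_in_path_image pathfinish_in_path_image)+
      \<comment> \<open>for these \<open>k\<close> the bounded part of the loop lies to the right of the cut\<close>
      define C where "C = closed_left_loop g (T k)"
      have C: "w \<in> left_loop_image g \<or> Re w = T k" if "w \<in> path_image C" for w
        using that path_image_closed_left_loop[OF Ts[unfolded s_def f_def]] by (auto simp: C_def)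
      have C_avoid: "path_image C \<inter> S = {}"
        using C avoid_g T0(2) by (auto simp: T_def)
      have subC: "path_image (linepath (Complex (T k) (Im s)) s) \<subseteq> path_image C"
          "path_image (linepath f (Complex (T k) (Im f))) \<subseteq> path_image C"
          "path_image (linepath (Complex (T k) (Im f)) (Complex (T k) (Im s))) \<subseteq> path_image C"
        by (auto simp: C_def closed_left_loop_def path_image_join s_def f_def)
      have int: "F contour_integrable_on linepath (Complex (T k) (Im s)) s"
          "F contour_integrable_on linepath f (Complex (T k) (Im f))"
          "F contour_integrable_on linepath (Complex (T k) (Im f)) (Complex (T k) (Im s))"
        using subC C_avoid by (blast intro: contour_integrable valid_path_linepath)+
      have "contour_integral C F = contour_integral (linepath (Complex (T k) (Im s)) s) F + (I2
        + (contour_integral (linepath f (Complex (T k) (Im f))) F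
        + contour_integral (linepath (Complex (T k) (Im f)) (Complex (T k) (Im s))) F))"
        unfolding C_def closed_left_loop_def I2_def s_def[symmetric] f_def[symmetric]
        using int contour_integrable[OF valid disj_g] valid
        by (simp add: s_def f_def)
      also have "contour_integral (linepath f (Complex (T k) (Im f))) F =
          - contour_integral (linepath (Complex (T k) (Im f)) f) F"
        using contour_integral_reversepath[of "linepath (Complex (T k) (Im f)) f" F] by simp
      finally have "contour_integral (linepath (Complex (T k) (Im s)) s) F + I2
          - contour_integral (linepath (Complex (T k) (Im f)) f) F
          + contour_integral (linepath (Complex (T k) (Im f)) (Complex (T k) (Im s))) F =
        contour_integral C F"
        by simp
      \<comment> \<open>the half-plane is taken one unit larger so as to be an open neighbourhood of the closed path\<close>
      also have "\<dots> = 2 * pi * \<i> * (\<Sum>p | p \<in> S \<and> T k - 1 < Re p. winding_number C p * residue F p)"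
      proof (rule Residue_theorem)
        show "open {w. T k - 1 < Re w}" "connected {w. T k - 1 < Re w}"
          by (auto intro: open_halfspace_Re_gt convex_connected convex_halfspace_Re_gt)
        show "finite {p. p \<in> S \<and> T k - 1 < Re p}"
          by (rule finite_subset[OF _ finite_right[of "T k - 1"]]) auto
        show "F holomorphic_on {w. T k - 1 < Re w} - {p. p \<in> S \<and> T k - 1 < Re p}"
          by (rule holomorphic_on_subset[OF holo]) auto
        show "valid_path C" "pathfinish C = pathstart C"
          using valid by (auto simp: C_def)
        have ge: "T k \<le> Re w" if "w \<in> path_image C" for w
        proof -
          have "path_image C \<subseteq> {w. T k \<le> Re w}"
            using Ts Re_g closed_segment_subset[OF _ _ convex_halfspace_Re_ge[of "T k"]]
            by (auto simp: C_def closed_left_loop_def path_image_join s_def f_def less_imp_le)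
          then show ?thesis
            using that by auto
        qed
        then show "path_image C \<subseteq> {w. T k - 1 < Re w} - {p. p \<in> S \<and> T k - 1 < Re p}"
          using C_avoid by force
        show "\<forall>z. z \<notin> {w. T k - 1 < Re w} \<longrightarrow> winding_number C z = 0"
          unfolding C_def using Re_g path
          by (auto intro!: winding_number_closed_left_loop_outside simp: less_imp_le)
      qed
      also have "(\<Sum>p | p \<in> S \<and> T k - 1 < Re p. winding_number C p * residue F p) =
          (\<Sum>p | p \<in> S \<inter> L \<and> T k < Re p. residue F p)"
      proof (rule sum.mono_neutral_cong_right)
        show "finite {p. p \<in> S \<and> T k - 1 < Re p}"
          by (rule finite_subset[OF _ finite_right[of "T k - 1"]]) auto
        have wn: "winding_number C p = w"
          if "\<forall>\<^sub>F T in at_bot. winding_number (closed_left_loop g T) p = w" "p \<notin> left_loop_image g"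
            "T k < Re p" for p w
          unfolding C_def
          by (rule winding_number_closed_left_loop_eventually[OF that(1) path that(2)])
             (use Ts that in \<open>auto simp: s_def f_def\<close>)
        show "\<forall>p\<in>{p. p \<in> S \<and> T k - 1 < Re p} - {p. p \<in> S \<inter> L \<and> T k < Re p}.
            winding_number C p * residue F p = 0"
        proof
          fix p assume p: "p \<in> {p. p \<in> S \<and> T k - 1 < Re p} - {p. p \<in> S \<inter> L \<and> T k < Re p}"
          have "winding_number C p = 0"
          proof (cases "T k < Re p")
            case True
            then show ?thesis
              using right[of p] p wn[of p 0] by (auto simp: on_right_of_loop_def)
          next
            case False
            then have "Re p < T k"
              using p T0(2)[of p k] by (auto simp: T_def)
            then show ?thesis
              unfolding C_def using Re_g path
              by (auto intro!: winding_number_closed_left_loop_outside simp: less_imp_le)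
          qed
          then show "winding_number C p * residue F p = 0"
            by simp
        qed
        show "winding_number C p * residue F p = residue F p"
          if "p \<in> {p. p \<in> S \<inter> L \<and> T k < Re p}" for p
          using left[of p] that wn[of p 1] by (auto simp: on_left_of_loop_def)
      qed auto
      finally show ?case
        by simp
    qed
  qed
  show thesis
    by (rule that[OF has lim[unfolded T_def]])
qed

end

section \<open>Left loops that separate two sets\<close>

text \<open>
  For each point, the path goes to a small circle around it, once around the circle, and back the
  same way, so that only the circle contributes to the winding numbers. A complement of a sparse set
  is connected, which provides the way.
\<close>

lemma exists_closed_path_around_finite:
  fixes D :: "complex set"
  assumes D: "D sparse_in UNIV" and "finite P" "P \<subseteq> D" and e: "e \<notin> D"
  shows "\<exists>\<gamma>. valid_path \<gamma> \<and> pathstart \<gamma> = e \<and> pathfinish \<gamma> = e \<and> path_image \<gamma> \<inter> D = {} \<and>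
    (\<forall>z\<in>D. winding_number \<gamma> z = (if z \<in> P then 1 else 0))"
  using \<open>finite P\<close> \<open>P \<subseteq> D\<close>
proof (induction P)
  case empty
  show ?case
  proof (intro exI[of _ "linepath e e"] conjI ballI)
    show "winding_number (linepath e e) z = (if z \<in> {} then 1 else 0)" if "z \<in> D" for z
      using that e by (metis empty_iff winding_number_trivial)
    show "path_image (linepath e e) \<inter> D = {}"
      using e by simp
  qed (simp_all only: valid_path_linepath pathstart_linepath pathfinish_linepath)
next
  case (insert p P)
  then obtain \<gamma> where \<gamma>: "valid_path \<gamma>" "pathstart \<gamma> = e" "pathfinish \<gamma> = e" "path_image \<gamma> \<inter> D = {}"
    and wn_\<gamma>: "\<And>z. z \<in> D \<Longrightarrow> winding_number \<gamma> z = (if z \<in> P then 1 else 0)"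
    by auto
  obtain W where "open W" "p \<in> W" and W: "\<And>y. y \<in> W \<Longrightarrow> y \<noteq> p \<Longrightarrow> y \<notin> D"
    using sparse_in_not_in[OF D UNIV_I] by metis
  then obtain \<epsilon> where "\<epsilon> > 0" "cball p \<epsilon> \<subseteq> W"
    by (auto simp: open_contains_cball)
  then have \<epsilon>: "z = p" if "z \<in> D" "z \<in> cball p \<epsilon>" for z
    using W that by blast
  define c where "c = circlepath p \<epsilon>"
  have c: "valid_path c" "pathstart c = p + \<epsilon>" "pathfinish c = p + \<epsilon>" "path_image c = sphere p \<epsilon>"
    using \<open>\<epsilon> > 0\<close> by (auto simp: c_def)
  have c_D: "path_image c \<inter> D = {}"
    using \<epsilon> \<open>\<epsilon> > 0\<close> unfolding c by force
  have open_D: "open (- D)"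
    using sparse_in_UNIV_imp_closed[OF D] by (simp add: open_Compl)
  moreover have "connected (- D)"
    using sparse_imp_connected[OF _ connected_UNIV open_UNIV D] by (simp add: Compl_eq_Diff_UNIV)
  moreover have "p + \<epsilon> \<notin> D"
    using c_D c(2) pathstart_in_path_image[of c] by auto
  ultimately obtain q where "polynomial_function q" and q: "path_image q \<subseteq> - D"
    "pathstart q = e" "pathfinish q = p + \<epsilon>"
    using connected_open_polynomial_connected[of "- D" e "p + \<epsilon>"] e by auto
  then have vq: "valid_path q"
    by (simp add: valid_path_polynomial_function)
  define \<gamma>' where "\<gamma>' = \<gamma> +++ (q +++ (c +++ reversepath q))"
  have "winding_number \<gamma>' z = (if z \<in> insert p P then 1 else 0)" if "z \<in> D" for z
  proof -
    have "winding_number c z = (if z = p then 1 else 0)"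
    proof (cases "z = p")
      case False
      then have "z \<notin> cball p \<epsilon>"
        using \<epsilon> that by blast
      then show ?thesis
        using False c by (subst winding_number_zero_outside[of c "cball p \<epsilon>"])
          (auto simp: valid_path_imp_path)
    qed (use \<open>\<epsilon> > 0\<close> in \<open>auto simp: c_def winding_number_circlepath_centre\<close>)
    moreover have "winding_number \<gamma>' z = winding_number \<gamma> z + (winding_number q z +
        (winding_number c z + winding_number (reversepath q) z))"
    proof -
      have "z \<notin> path_image \<gamma>" "z \<notin> path_image q" "z \<notin> path_image c"
        using that \<gamma>(4) q(1) c_D by auto
      then show ?thesis
        using \<gamma> c q vq unfolding \<gamma>'_def
        by (simp add: winding_number_join not_in_path_image_join valid_path_imp_path)
    qed
    moreover have "winding_number (reversepath q) z = - winding_number q z"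
      using that q vq by (intro winding_number_reversepath) (auto simp: valid_path_imp_path)
    ultimately show ?thesis
      using wn_\<gamma>[OF that] \<open>p \<notin> P\<close> by auto
  qed
  moreover have "path_image \<gamma>' \<inter> D = {}"
    using \<gamma> c q c_D unfolding \<gamma>'_def by (auto simp: path_image_join)
  ultimately show ?case
    using \<gamma> c q vq by (intro exI[of _ \<gamma>']) (auto simp: \<gamma>'_def)
qed

text \<open>
  The loop is a vertical segment to the left of \<open>N\<close>, with its two rays, followed by a closed path
  around the finitely many points of \<open>A\<close> on the right of the segment. Its self-intersections spare a
  discussion of how \<open>A\<close> and \<open>N\<close> interlace.
\<close>

lemma exists_left_loop_separating:
  assumes A: "\<And>T. finite {z \<in> A. T \<le> Re z}" and B: "\<And>z. z \<in> A \<Longrightarrow> \<bar>Im z\<bar> < B"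
    and N: "N sparse_in UNIV" "\<And>z. z \<in> N \<Longrightarrow> c0 \<le> Re z"
    and disj: "A \<inter> N = {}" and "0 < B"
  obtains g where "left_loop g" "\<And>z. z \<in> A \<Longrightarrow> on_left_of_loop g z"
    "\<And>z. z \<in> N \<Longrightarrow> on_right_of_loop g z"
proof -
  define D where "D = A \<union> N"
  have A_sparse: "A sparse_in UNIV"
    by (rule sparse_in_UNIV_if_finite_right[OF A])
  then have D: "D sparse_in UNIV"
    using N sparse_in_union' by (auto simp: D_def)
  have "countable (Re ` A)"
    using sparse_imp_countable[OF open_UNIV A_sparse] by auto
  then have "{c0 - 1<..<c0} - Re ` A \<noteq> {}"
    using uncountable_open_interval[of "c0 - 1" c0] uncountable_minus_countable
    by (metis countable_empty diff_strict_left_mono diff_zero zero_less_one)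
  then obtain c where "c < c0" "c \<notin> Re ` A"
    unfolding ex_in_conv[symmetric] by auto
  then have c: "Re z \<noteq> c" if "z \<in> A" for z
    using that by auto
  have D_c: "Re z \<noteq> c" if "z \<in> D" for z
    using that c N(2)[of z] \<open>c < c0\<close> by (auto simp: D_def)
  \<comment> \<open>the path around the points on the right starts from the upper end of the segment\<close>
  define \<alpha> \<omega> where "\<alpha> = Complex c (- B)" and "\<omega> = Complex c B"
  obtain \<gamma> where \<gamma>: "valid_path \<gamma>" "pathstart \<gamma> = \<omega>" "pathfinish \<gamma> = \<omega>" "path_image \<gamma> \<inter> D = {}"
    and wn_\<gamma>: "\<And>z. z \<in> D \<Longrightarrow> winding_number \<gamma> z = (if z \<in> {z \<in> A. c \<le> Re z} then 1 else 0)"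
    using exists_closed_path_around_finite[OF D A[of c], of \<omega>] D_c
    by (fastforce simp: D_def \<omega>_def)
  define g where "g = linepath \<alpha> \<omega> +++ \<gamma>"
  have ends: "pathstart g = \<alpha>" "pathfinish g = \<omega>"
    by (auto simp: g_def \<gamma>)
  have valid: "valid_path g" and path: "path g"
    using \<gamma> by (auto simp: g_def valid_path_imp_path)
  have z_lin: "z \<notin> closed_segment \<alpha> \<omega>" if "z \<in> D" for z
    using D_c[OF that] by (auto simp: \<alpha>_def \<omega>_def closed_segment_same_Re)
  have lin_image: "left_loop_image (linepath \<alpha> \<omega>) \<inter> D = {}"
    using z_lin B N(2) \<open>c < c0\<close> by (force simp: left_loop_image_def D_def \<alpha>_def \<omega>_def)
  have g_image: "left_loop_image g \<inter> D = {}"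
    using lin_image \<gamma> by (auto simp: left_loop_image_def g_def path_image_join)
  have wn: "winding_number (closed_left_loop g T) z =
      winding_number (rectpath (Complex T (- B)) \<omega>) z + winding_number \<gamma> z"
    if "z \<in> D" "T < min c (Re z)" for z T
  proof -
    have "rectpath (Complex T (- B)) \<omega> = closed_left_loop (linepath \<alpha> \<omega>) T"
      by (simp add: rectpath_def Let_def closed_left_loop_def \<alpha>_def \<omega>_def)
    moreover have "winding_number g z = winding_number (linepath \<alpha> \<omega>) z + winding_number \<gamma> z"
      unfolding g_def
    proof (rule winding_number_join)
      show "z \<notin> path_image (linepath \<alpha> \<omega>)" "z \<notin> path_image \<gamma>"
        using that(1) z_lin \<gamma>(4) by auto
    qed (use \<gamma> in \<open>simp_all add: valid_path_imp_path\<close>)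
    moreover have z_g: "z \<notin> left_loop_image g" and z_lin': "z \<notin> left_loop_image (linepath \<alpha> \<omega>)"
      using that(1) g_image lin_image by auto
    ultimately show ?thesis
      using winding_number_closed_left_loop[of T g z] winding_number_closed_left_loop[of T "linepath \<alpha> \<omega>" z]
        that path z_g z_lin'
      by (simp add: ends) (simp add: \<alpha>_def \<omega>_def)
  qed
  have small: "\<forall>\<^sub>F T in at_bot. T < min c (Re z)" for z
    by (rule eventually_gt_at_bot)
  show thesis
  proof
    show "left_loop g"
      using valid \<open>0 < B\<close> by (simp add: left_loop_def ends \<alpha>_def \<omega>_def)
    show "on_left_of_loop g z" if "z \<in> A" for z
    proof -
      have "\<forall>\<^sub>F T in at_bot. winding_number (closed_left_loop g T) z = 1"
        using small[of z]
      proof eventually_elim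
        case (elim T)
        show ?case
        proof (cases "c \<le> Re z")
          case True
          then have "winding_number (rectpath (Complex T (- B)) \<omega>) z = 0"
            using elim c[OF that] \<open>0 < B\<close>
            by (intro winding_number_rectpath_outside) (auto simp: \<omega>_def in_cbox_complex_iff)
          then show ?thesis
            using wn[of z T] wn_\<gamma>[of z] elim True that by (simp add: D_def)
        next
          case False
          then have "winding_number (rectpath (Complex T (- B)) \<omega>) z = 1"
            using elim B[OF that] by (intro winding_number_rectpath) (auto simp: \<omega>_def in_box_complex_iff)
          then show ?thesis
            using wn[of z T] wn_\<gamma>[of z] elim False that by (simp add: D_def)
        qed
      qed
      then show ?thesis
        using g_image that by (auto simp: on_left_of_loop_def D_def)
    qed
    show "on_right_of_loop g z" if "z \<in> N" for z
    proof -
      have "z \<notin> A"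
        using disj that by blast
      have "\<forall>\<^sub>F T in at_bot. winding_number (closed_left_loop g T) z = 0"
        using small[of z]
      proof eventually_elim
        case (elim T)
        have "winding_number (rectpath (Complex T (- B)) \<omega>) z = 0"
          using elim N(2)[OF that] \<open>c < c0\<close> \<open>0 < B\<close>
          by (intro winding_number_rectpath_outside) (auto simp: \<omega>_def in_cbox_complex_iff)
        then show ?case
          using wn[of z T] wn_\<gamma>[of z] elim \<open>z \<notin> A\<close> that by (simp add: D_def)
      qed
      then show ?thesis
        using g_image that by (auto simp: on_right_of_loop_def D_def)
    qed
  qed
qed

section \<open>The common integrand\<close>

lemma eventually_at_notin_Ints: "\<forall>\<^sub>F w in at z. w \<notin> (\<int> :: 'a::real_normed_algebra_1 set)"
proof -
  have "closed (\<int> - {z})"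
    by (rule closed_subset_Ints) auto
  then have "\<forall>\<^sub>F w in nhds z. w \<in> - (\<int> - {z})"
    using eventually_nhds_in_open[OF open_Compl] by blast
  then show ?thesis
    by (auto simp: eventually_at_filter elim: eventually_mono)
qed

lemma analytic_on_pochhammer [analytic_intros]:
  fixes f :: "complex \<Rightarrow> complex"
  assumes "f analytic_on A"
  shows "(\<lambda>s. pochhammer (f s) n) analytic_on A"
  unfolding pochhammer_prod using assms by (intro analytic_intros)

lemma Gamma_meromorphic_on [meromorphic_intros]:
  fixes f :: "complex \<Rightarrow> complex"
  assumes "f analytic_on A"
  shows "(\<lambda>s. Gamma (f s)) meromorphic_on A"
proof -
  have "(\<lambda>s. inverse (rGamma (f s))) meromorphic_on A"
    using assms by (intro meromorphic_on_inverse analytic_on_imp_meromorphic_on analytic_on_rGamma)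
  then show ?thesis
    by (simp add: rGamma_inverse_Gamma)
qed

lemma tendsto_translate_quotient_at_infinity:
  fixes c d :: "'a::real_normed_field"
  shows "((\<lambda>s. (c + s) / (d + s)) \<longlongrightarrow> 1) at_infinity"
proof -
  have lim: "filterlim (\<lambda>s::'a. d + s) at_infinity at_infinity"
    by (rule tendsto_add_filterlim_at_infinity[OF tendsto_const filterlim_ident])
  have "((\<lambda>s. 1 + (c - d) / (d + s)) \<longlongrightarrow> 1 + 0) at_infinity"
    by (intro tendsto_intros tendsto_divide_0[OF tendsto_const lim])
  then have "((\<lambda>s. 1 + (c - d) / (d + s)) \<longlongrightarrow> 1) at_infinity"
    by simp
  moreover have "\<forall>\<^sub>F s in at_infinity. 1 + (c - d) / (d + s) = (c + s) / (d + s)"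
    using filterlim_at_infinity_imp_eventually_ne[OF lim, of 0]
    by eventually_elim (simp add: field_simps)
  ultimately show ?thesis
    by (rule Lim_transform_eventually)
qed

text \<open>
  The reciprocals of the Gamma functions in the denominator are entire and are written as such. So
  the function takes its proper values except at the points of the two sets defined next.
\<close>

definition meijer_kernel :: "complex ^ 'p \<Rightarrow> complex ^ 'p \<Rightarrow> nat \<Rightarrow> real \<Rightarrow> complex \<Rightarrow> complex" where
  "meijer_kernel a b n x s =
     (\<Prod>i\<in>UNIV. Gamma (a $ i + of_nat n - 1 + s) * rGamma (b $ i + of_nat n - 1 + s)) *
     of_real x powr (- s) / pochhammer s n"

definition numerator_poles :: "complex ^ 'p \<Rightarrow> nat \<Rightarrow> complex set" where
  "numerator_poles a n = {1 - a $ j - of_nat n - of_nat l | j l. True}"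

definition denominator_zeros :: "nat \<Rightarrow> complex set" where
  "denominator_zeros n = (\<lambda>m. - of_nat m) ` {..<n}"

lemma numerator_poles_iff:
  "s \<in> numerator_poles a n \<longleftrightarrow> (\<exists>i. a $ i + of_nat n - 1 + s \<in> \<int>\<^sub>\<le>\<^sub>0)"
proof
  assume "s \<in> numerator_poles a n"
  then obtain j l where "s = 1 - a $ j - of_nat n - of_nat l"
    by (auto simp: numerator_poles_def)
  then have "a $ j + of_nat n - 1 + s = - of_nat l"
    by simp
  then show "\<exists>i. a $ i + of_nat n - 1 + s \<in> \<int>\<^sub>\<le>\<^sub>0"
    by (metis minus_of_nat_in_nonpos_Ints)
next
  assume "\<exists>i. a $ i + of_nat n - 1 + s \<in> \<int>\<^sub>\<le>\<^sub>0"
  then obtain i l where "a $ i + of_nat n - 1 + s = - of_nat l"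
    by (auto elim: nonpos_Ints_cases')
  then have "s = 1 - a $ i - of_nat n - of_nat l"
    by (simp add: algebra_simps eq_neg_iff_add_eq_0)
  then show "s \<in> numerator_poles a n"
    by (auto simp: numerator_poles_def)
qed

lemma denominator_zeros_iff: "s \<in> denominator_zeros n \<longleftrightarrow> pochhammer s n = 0"
  by (auto simp: denominator_zeros_def pochhammer_eq_0_iff)

lemma finite_numerator_poles_right: "finite {z \<in> numerator_poles a n. T \<le> Re z}"
proof (rule finite_subset)
  show "{z \<in> numerator_poles a n. T \<le> Re z} \<subseteq>
      (\<Union>j. (\<lambda>l. 1 - a $ j - of_nat n - of_nat l) ` {..nat \<lceil>1 - Re (a $ j) - n - T\<rceil>})"
  proof
    fix z assume "z \<in> {z \<in> numerator_poles a n. T \<le> Re z}"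
    then obtain j l where z: "z = 1 - a $ j - of_nat n - of_nat l" "T \<le> Re z"
      by (auto simp: numerator_poles_def)
    then have "real l \<le> 1 - Re (a $ j) - n - T"
      by simp
    then have "l \<le> nat \<lceil>1 - Re (a $ j) - n - T\<rceil>"
      by linarith
    then show "z \<in> (\<Union>j. (\<lambda>l. 1 - a $ j - of_nat n - of_nat l) ` {..nat \<lceil>1 - Re (a $ j) - n - T\<rceil>})"
      using z(1) by auto
  qed
qed auto

lemma finite_denominator_zeros: "finite (denominator_zeros n)"
  by (simp add: denominator_zeros_def)

lemma kernel_analytic_at:
  assumes "x > 0" "z \<notin> numerator_poles a n" "z \<notin> denominator_zeros n"
  shows "meijer_kernel a b n x analytic_on {z}"
  using assms unfolding meijer_kernel_def[abs_def]
  by (intro analytic_intros) (auto simp: numerator_poles_iff denominator_zeros_iff)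

lemma kernel_meromorphic:
  assumes "x > 0"
  shows "meijer_kernel a b n x meromorphic_on UNIV"
  using assms unfolding meijer_kernel_def[abs_def]
  by (intro meromorphic_intros analytic_on_imp_meromorphic_on[where f = "\<lambda>s. pochhammer (_ s) _"] analytic_on_imp_meromorphic_on[where f = "\<lambda>s. rGamma (_ s)"]
      analytic_on_imp_meromorphic_on[where f = "\<lambda>s. _ powr (_ s)"] analytic_intros) auto

lemma Gamma_vec_quotient:
  "Gamma_vec (shift_vec a (of_nat n - 1 + s)) / Gamma_vec (shift_vec b (of_nat n - 1 + s)) =
    (\<Prod>i\<in>UNIV. Gamma (a $ i + of_nat n - 1 + s) * rGamma (b $ i + of_nat n - 1 + s))"
  by (simp add: Gamma_vec_def shift_vec_def rGamma_inverse_Gamma prod_dividef[symmetric]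
      divide_inverse[symmetric] algebra_simps)

lemma G_tilde_integrand_eq_kernel:
  assumes "s \<notin> \<int>"
  shows "G_tilde_integrand a b n x s = meijer_kernel a b n x s"
proof -
  have "s \<notin> \<int>\<^sub>\<le>\<^sub>0"
    using assms by auto
  then have "Gamma s / Gamma (of_nat n + s) = 1 / pochhammer s n"
    by (simp add: pochhammer_Gamma add.commute)
  then show ?thesis
    unfolding G_tilde_integrand_def meijer_kernel_def times_divide_times_eq[symmetric] Gamma_vec_quotient by simp
qed

lemma G_hat_integrand_eq_kernel:
  assumes "s \<notin> \<int>"
  shows "G_hat_integrand a b n x s = (-1) ^ n * meijer_kernel a b n x s"
proof -
  have "1 - of_nat n - s \<notin> \<int>\<^sub>\<le>\<^sub>0"
  proof
    assume "1 - of_nat n - s \<in> \<int>\<^sub>\<le>\<^sub>0"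
    then have "1 - of_nat n - (1 - of_nat n - s) \<in> \<int>"
      by (intro Ints_diff) auto
    then show False
      using assms by simp
  qed
  then have "Gamma (1 - of_nat n - s) / Gamma (1 - s) = 1 / pochhammer (1 - of_nat n - s) n"
    by (simp add: pochhammer_Gamma)
  also have "pochhammer (1 - of_nat n - s) n = (-1) ^ n * pochhammer s n"
    using pochhammer_minus'[of "- s" n] by (simp add: algebra_simps)
  finally have "Gamma (1 - of_nat n - s) / Gamma (1 - s) = (-1) ^ n / pochhammer s n"
    by (cases "even n") auto
  then show ?thesis
    unfolding G_hat_integrand_def meijer_kernel_def times_divide_times_eq[symmetric] Gamma_vec_quotient by simp
qed

definition kernel_ratio :: "complex ^ 'p \<Rightarrow> complex ^ 'p \<Rightarrow> nat \<Rightarrow> real \<Rightarrow> complex \<Rightarrow> complex" where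
  "kernel_ratio a b n x s =
     (\<Prod>i\<in>UNIV. ((b $ i + of_nat n - 2) + s) / ((a $ i + of_nat n - 2) + s)) *
     (((of_nat n - 1) + s) / (- 1 + s)) * of_real x"

lemma kernel_shift:
  assumes "x > 0" "s \<notin> \<int>" "s - 1 \<notin> numerator_poles a n"
  shows "meijer_kernel a b n x (s - 1) = kernel_ratio a b n x s * meijer_kernel a b n x s"
proof -
  have 1: "Gamma (a $ i + of_nat n - 1 + (s - 1)) * rGamma (b $ i + of_nat n - 1 + (s - 1)) =
      (((b $ i + of_nat n - 2) + s) / ((a $ i + of_nat n - 2) + s)) *
      (Gamma (a $ i + of_nat n - 1 + s) * rGamma (b $ i + of_nat n - 1 + s))" for i
  proof -
    define u v where "u = a $ i + of_nat n - 2 + s" and "v = b $ i + of_nat n - 2 + s"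
    have eq: "a $ i + of_nat n - 1 + (s - 1) = u" "b $ i + of_nat n - 1 + (s - 1) = v"
        "a $ i + of_nat n - 1 + s = u + 1" "b $ i + of_nat n - 1 + s = v + 1"
      by (simp_all add: u_def v_def)
    have u: "u \<notin> \<int>\<^sub>\<le>\<^sub>0"
      using assms(3) unfolding numerator_poles_iff eq(1)[symmetric] by blast
    then have "u \<noteq> 0"
      by auto
    have "Gamma u * rGamma v = v / u * (Gamma (u + 1) * rGamma (v + 1))"
      using Gamma_plus1[OF u] rGamma_plus1[of v] \<open>u \<noteq> 0\<close> by (simp add: field_simps)
    then show ?thesis
      unfolding eq u_def[symmetric] v_def[symmetric] .
  qed
  have "pochhammer s n \<noteq> 0" "s - 1 + of_nat n \<noteq> 0" "s - 1 \<noteq> 0"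
  proof -
    show "pochhammer s n \<noteq> 0"
      using assms(2) by (auto simp: pochhammer_eq_0_iff)
    show "s - 1 + of_nat n \<noteq> 0"
    proof
      assume "s - 1 + of_nat n = 0"
      then have "s = 1 - of_nat n"
        by (simp add: algebra_simps)
      then show False
        using assms(2) by simp
    qed
    show "s - 1 \<noteq> 0"
      using assms(2) by auto
  qed
  moreover have "(s - 1) * pochhammer s n = (s - 1 + of_nat n) * pochhammer (s - 1) n"
    using pochhammer_rec[of "s - 1" n] pochhammer_rec'[of "s - 1" n] by simp
  ultimately have 2: "1 / pochhammer (s - 1) n = (s - 1 + of_nat n) / (s - 1) / pochhammer s n"
    by (cases "pochhammer (s - 1) n = 0") (simp_all add: divide_simps mult_ac)
  have 3: "of_real x powr (- (s - 1)) = of_real x * of_real x powr (- s :: complex)"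
    using assms(1) powr_add[of "of_real x" 1 "- s"] by simp
  have "meijer_kernel a b n x (s - 1) = (\<Prod>i\<in>UNIV. Gamma (a $ i + of_nat n - 1 + (s - 1)) *
      rGamma (b $ i + of_nat n - 1 + (s - 1))) * of_real x powr (- (s - 1)) * (1 / pochhammer (s - 1) n)"
    by (simp add: meijer_kernel_def)
  also have "\<dots> = kernel_ratio a b n x s * meijer_kernel a b n x s"
    unfolding 1 2 3 prod.distrib meijer_kernel_def kernel_ratio_def
    by (simp only: times_divide_eq_left times_divide_eq_right mult_ac divide_divide_eq_left
        diff_conv_add_uminus add_ac mult_1_left mult_1_right)
  finally show ?thesis .
qed

text \<open>
  The reason why the integrand decays: each of its linear factors in the numerator is matched by one
  in the denominator.
\<close>

lemma kernel_ratio_tendsto: "(kernel_ratio a b n x \<longlongrightarrow> of_real x) at_infinity"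
proof -
  have "(kernel_ratio a b n x \<longlongrightarrow> (\<Prod>i\<in>(UNIV :: 'p set). 1) * 1 * of_real x) at_infinity"
    for a b :: "complex ^ 'p"
    unfolding kernel_ratio_def[abs_def]
    by (intro tendsto_intros tendsto_translate_quotient_at_infinity)
  then show ?thesis
    by simp
qed

text \<open>
  Splitting \<open>(s)\<^sub>n = (s)\<^sub>m (s + m) (s + m + 1)\<^bsub>n - 1 - m\<^esub>\<close> isolates the simple zero at \<open>-m\<close>; the
  other two factors are \<open>(-m)\<^sub>m\<close> and \<open>(1)\<^bsub>n - 1 - m\<^esub>\<close> there.
\<close>

lemma residue_kernel:
  assumes "x > 0" "m < n" "- of_nat m \<notin> numerator_poles a n"
  shows "residue (meijer_kernel a b n x) (- of_nat m) =
    (\<Prod>i\<in>UNIV. Gamma (a $ i + of_nat (n - 1 - m)) * rGamma (b $ i + of_nat (n - 1 - m))) *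
    (- of_real x) ^ m / (fact m * fact (n - 1 - m))"
proof -
  define h where "h s = (\<Prod>i\<in>UNIV. Gamma (a $ i + of_nat n - 1 + s) * rGamma (b $ i + of_nat n - 1 + s)) *
     of_real x powr (- s) / (pochhammer s m * pochhammer (s + of_nat m + 1) (n - 1 - m))" for s
  have "pochhammer s n = pochhammer s m * ((s + of_nat m) * pochhammer (s + of_nat m + 1) (n - 1 - m))"
    for s :: complex
    using assms(2) pochhammer_product[of m n s] pochhammer_rec[of "s + of_nat m" "n - 1 - m"]
    by (simp add: Suc_diff_Suc)
  then have kernel_eq: "meijer_kernel a b n x = (\<lambda>s. h s / (s - (- of_nat m)))"
    by (simp add: meijer_kernel_def h_def fun_eq_iff)
  have poch: "pochhammer (- of_nat m :: complex) m = (-1) ^ m * fact m"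
    by (rule pochhammer_same)
  have "h analytic_on {- of_nat m}"
    using assms poch unfolding h_def
    by (intro analytic_intros) (auto simp: numerator_poles_iff simp flip: pochhammer_fact)
  then obtain W where "open W" "- of_nat m \<in> W" "h holomorphic_on W"
    by (auto simp: analytic_at)
  then have "residue (meijer_kernel a b n x) (- of_nat m) = h (- of_nat m)"
    unfolding kernel_eq by (rule residue_simple)
  also have "of_real x powr (- (- of_nat m)) = (of_real x :: complex) ^ m"
    using assms(1) by (simp add: powr_nat')
  then have "h (- of_nat m) = (\<Prod>i\<in>UNIV. Gamma (a $ i + of_nat (n - 1 - m)) * rGamma (b $ i + of_nat (n - 1 - m))) *
    of_real x ^ m / (((-1) ^ m * fact m) * fact (n - 1 - m))"
    using assms(2) unfolding h_def poch by (simp add: pochhammer_fact[symmetric] of_nat_diff algebra_simps)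
  also have "\<dots> = (\<Prod>i\<in>UNIV. Gamma (a $ i + of_nat (n - 1 - m)) * rGamma (b $ i + of_nat (n - 1 - m))) *
    (- of_real x) ^ m / (fact m * fact (n - 1 - m))"
    by (simp add: power_minus[of "of_real x" m] field_simps)
  finally show ?thesis .
qed

lemma is_pole_kernel_imp:
  assumes "x > 0" "is_pole (meijer_kernel a b n x) z"
  shows "z \<in> numerator_poles a n \<union> denominator_zeros n"
proof (rule ccontr)
  assume "z \<notin> numerator_poles a n \<union> denominator_zeros n"
  then have "meijer_kernel a b n x analytic_on {z}"
    using assms by (intro kernel_analytic_at) auto
  then show False
    using assms(2) analytic_at_imp_no_pole by blast
qed

lemma is_pole_G_tilde_integrand_iff:
  "is_pole (G_tilde_integrand a b n x) z \<longleftrightarrow> is_pole (meijer_kernel a b n x) z"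
proof (rule is_pole_cong)
  show "\<forall>\<^sub>F w in at z. G_tilde_integrand a b n x w = meijer_kernel a b n x w"
    using eventually_at_notin_Ints[of z] by eventually_elim (rule G_tilde_integrand_eq_kernel)
qed simp

lemma numerator_poles_sparse: "numerator_poles a n sparse_in UNIV"
  by (rule sparse_in_UNIV_if_finite_right[OF finite_numerator_poles_right])

lemma Ints_sparse: "(\<int> :: complex set) sparse_in UNIV"
  using eventually_at_notin_Ints by (auto simp: sparse_in_eventually_iff)

lemma kernel_isolated_singularity:
  assumes "x > 0"
  shows "isolated_singularity_at (meijer_kernel a b n x) z"
  using meromorphic_on_isolated_singularity[OF meromorphic_on_subset[OF kernel_meromorphic[OF assms]]]
  by blast

text \<open>
  The shift relation holds away from the exceptional points of the kernel. It is extended to the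
  removable singularities by continuity, so that only true poles count as singularities.
\<close>

lemma kernel_left_decaying:
  assumes "0 < x" "x < 1"
  obtains M where "left_decaying (remove_sings (meijer_kernel a b n x)) {z. is_pole (meijer_kernel a b n x) z}
    ((1 + x) / 2) M"
proof -
  define H where "H = meijer_kernel a b n x"
  define F where "F = remove_sings H"
  define r where "r = (1 + x) / 2"
  note isol = kernel_isolated_singularity[OF assms(1), of a b n, folded H_def]
  have analytic: "F analytic_on {z}" if "\<not> is_pole H z" for z
  proof (rule nicely_meromorphic_on_imp_analytic_at)
    show "F nicely_meromorphic_on UNIV"
      unfolding F_def H_def by (rule remove_sings_nicely_meromorphic[OF kernel_meromorphic[OF assms(1)]])
    show "\<not> is_pole F z"
      using that isol by (simp add: F_def)
  qed simp
  have "((\<lambda>s. norm (kernel_ratio a b n x s)) \<longlongrightarrow> norm (complex_of_real x)) at_infinity"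
    by (intro tendsto_norm kernel_ratio_tendsto)
  then have "\<forall>\<^sub>F s in at_infinity. norm (kernel_ratio a b n x s) < r"
    using assms by (intro order_tendstoD(2)) (auto simp: r_def)
  then obtain B where B: "\<And>s. B \<le> norm s \<Longrightarrow> norm (kernel_ratio a b n x s) < r"
    by (auto simp: eventually_at_infinity)
  \<comment> \<open>the further unit keeps a neighbourhood of \<open>s\<close> in the region \<open>B \<le> |w|\<close>\<close>
  have step: "norm (F (s - 1)) \<le> r * norm (F s)"
    if s: "Re s \<le> - B - 1" "\<not> is_pole H s" "\<not> is_pole H (s - 1)" for s
  proof (rule tendsto_le)
    have shift: "filterlim (\<lambda>w. w - 1) (at (s - 1)) (at s)"
      by (rule filterlim_atI) (auto intro!: tendsto_intros simp: eventually_at_filter)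
    show "((\<lambda>w. r * norm (F w)) \<longlongrightarrow> r * norm (F s)) (at s)"
      using analytic_at_imp_isCont[OF analytic[OF s(2)]] by (intro tendsto_intros isContD)
    show "((\<lambda>w. norm (F (w - 1))) \<longlongrightarrow> norm (F (s - 1))) (at s)"
      using isContD[OF analytic_at_imp_isCont[OF analytic[OF s(3)]]]
      by (intro tendsto_norm filterlim_compose[OF _ shift])
    have "\<forall>\<^sub>F w in at s. w \<in> ball s 1"
      by (intro eventually_at_in_open') auto
    moreover have "\<forall>\<^sub>F w in at s. F w = H w"
      unfolding F_def by (rule eventually_remove_sings_eq_at[OF isol])
    moreover have "\<forall>\<^sub>F w in at s. F (w - 1) = H (w - 1)"
      unfolding F_def by (rule eventually_compose_filterlim[OF eventually_remove_sings_eq_at[OF isol] shift])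
    moreover have "\<forall>\<^sub>F w in at (s - 1). w \<notin> numerator_poles a n"
      using numerator_poles_sparse[of a n] by (simp add: sparse_in_eventually_iff)
    then have "\<forall>\<^sub>F w in at s. w - 1 \<notin> numerator_poles a n"
      by (rule eventually_compose_filterlim[OF _ shift])
    moreover note eventually_at_notin_Ints[of s]
    ultimately show "\<forall>\<^sub>F w in at s. norm (F (w - 1)) \<le> r * norm (F w)"
    proof eventually_elim
      case (elim w)
      have "\<bar>Re (s - w)\<bar> < 1"
        using elim(1) abs_Re_le_cmod[of "s - w"] by (simp add: dist_norm)
      then have "B \<le> norm w"
        using s(1) abs_Re_le_cmod[of w] by simp
      then show ?case
        using B[of w] kernel_shift[of x w a n b] assms(1) elim
        by (simp add: H_def norm_mult mult_right_mono less_imp_le)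
    qed
  qed simp
  have fin: "finite {z \<in> {z. is_pole H z}. T \<le> Re z}" for T
  proof (rule finite_subset)
    show "{z \<in> {z. is_pole H z}. T \<le> Re z} \<subseteq>
        {z \<in> numerator_poles a n. T \<le> Re z} \<union> denominator_zeros n"
      using is_pole_kernel_imp[OF assms(1)] by (auto simp: H_def)
  qed (use finite_numerator_poles_right finite_denominator_zeros in auto)
  have holo: "F holomorphic_on - {z. is_pole H z}"
    using analytic analytic_imp_holomorphic analytic_on_analytic_at
    by (metis (no_types, lifting) ComplD mem_Collect_eq)
  have "left_decaying F {z. is_pole H z} r (- B - 1)"
    using assms step holo fin by unfold_locales (auto simp: r_def)
  then show thesis
    using that unfolding F_def H_def r_def by blast
qed

section \<open>Admissible loops\<close>

lemma numerator_poles_Im_bound: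
  "z \<in> numerator_poles a n \<Longrightarrow> \<bar>Im z\<bar> < 1 + (\<Sum>i\<in>UNIV. \<bar>Im (a $ i)\<bar>)"
proof -
  assume "z \<in> numerator_poles a n"
  then obtain j where "\<bar>Im z\<bar> = \<bar>Im (a $ j)\<bar>"
    by (auto simp: numerator_poles_def)
  moreover have "\<bar>Im (a $ j)\<bar> \<le> (\<Sum>i\<in>UNIV. \<bar>Im (a $ i)\<bar>)"
    by (rule member_le_sum) auto
  ultimately show ?thesis
    by simp
qed

lemma sum_Im_bound_pos: "0 < 1 + (\<Sum>i\<in>UNIV. \<bar>Im ((a :: complex ^ 'p) $ i)\<bar>)"
  by (intro add_pos_nonneg sum_nonneg) auto

lemma G_tilde_loop_exists:
  assumes "x > 0"
  shows "\<exists>g. G_tilde_loop a b n x g"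
proof -
  define A where "A = numerator_poles a n \<union> denominator_zeros n"
  obtain g where "left_loop g" "\<And>z. z \<in> A \<Longrightarrow> on_left_of_loop g z"
  proof (rule exists_left_loop_separating[of A "1 + (\<Sum>i\<in>UNIV. \<bar>Im (a $ i)\<bar>)" "{}" 0])
    show "finite {z \<in> A. T \<le> Re z}" for T
    proof (rule finite_subset)
      show "{z \<in> A. T \<le> Re z} \<subseteq> {z \<in> numerator_poles a n. T \<le> Re z} \<union> denominator_zeros n"
        by (auto simp: A_def)
    qed (use finite_numerator_poles_right finite_denominator_zeros in auto)
    show "\<bar>Im z\<bar> < 1 + (\<Sum>i\<in>UNIV. \<bar>Im (a $ i)\<bar>)" if "z \<in> A" for z
      using that numerator_poles_Im_bound sum_Im_bound_pos[of a]
      by (auto simp: A_def denominator_zeros_def)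
  qed (use sum_Im_bound_pos[of a] in auto)
  then have "on_left_of_loop g z" if "is_pole (meijer_kernel a b n x) z" for z
    using is_pole_kernel_imp[OF assms that] by (simp add: A_def)
  then show ?thesis
    using \<open>left_loop g\<close>
    by (intro exI[of _ g]) (simp add: G_tilde_loop_def is_pole_G_tilde_integrand_iff)
qed

lemma numerator_poles_disjoint:
  fixes a :: "complex ^ 'p"
  assumes "\<And>i. - (a $ i) \<notin> \<nat>"
  shows "1 - of_nat n + of_nat k \<notin> numerator_poles a n"
proof
  assume "1 - of_nat n + of_nat k \<in> numerator_poles a n"
  then obtain j l where "1 - of_nat n + of_nat k = 1 - a $ j - of_nat n - of_nat l"
    by (auto simp: numerator_poles_def)
  then have "of_nat (k + l) = - (a $ j)"
    by (simp add: algebra_simps eq_neg_iff_add_eq_0)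
  then show False
    using assms[of j] by (metis of_nat_in_Nats)
qed

lemma denominator_zeros_subset:
  "z \<in> denominator_zeros n \<Longrightarrow> \<exists>k. z = 1 - of_nat n + of_nat k"
proof -
  assume "z \<in> denominator_zeros n"
  then obtain m where "m < n" "z = - of_nat m"
    by (auto simp: denominator_zeros_def)
  then have "z = 1 - of_nat n + of_nat (n - 1 - m)"
    by (simp add: of_nat_diff)
  then show ?thesis
    by blast
qed

text \<open>
  The two families of points are disjoint because of the hypothesis on \<open>a\<close>; this is the condition
  under which a loop can separate them.
\<close>

lemma G_hat_loop_exists:
  fixes a :: "complex ^ 'p"
  assumes "\<And>i. - (a $ i) \<notin> \<nat>"
  shows "\<exists>g. G_hat_loop a n g"
proof -
  define N where "N = range (\<lambda>k. 1 - of_nat n + of_nat k :: complex)"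
  obtain g where "left_loop g" "\<And>z. z \<in> numerator_poles a n \<Longrightarrow> on_left_of_loop g z"
    "\<And>z. z \<in> N \<Longrightarrow> on_right_of_loop g z"
  proof (rule exists_left_loop_separating[of "numerator_poles a n" "1 + (\<Sum>i\<in>UNIV. \<bar>Im (a $ i)\<bar>)" N "1 - real n"])
    show "N sparse_in UNIV"
      by (rule sparse_in_subset2[OF Ints_sparse]) (auto simp: N_def)
    show "numerator_poles a n \<inter> N = {}"
      using numerator_poles_disjoint[OF assms] by (auto simp: N_def)
  qed (use sum_Im_bound_pos[of a] numerator_poles_Im_bound finite_numerator_poles_right in \<open>auto simp: N_def\<close>)
  then show ?thesis
    by (intro exI[of _ g]) (auto simp: G_hat_loop_def N_def numerator_poles_def)
qed

section \<open>The difference of the two functions\<close>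

text \<open>
  Both loop integrals are limits of partial sums of residues of the kernel. The sums for the first
  function run over all poles, those for the second one over the poles of the numerator, and from
  some point on they differ by the residues at the zeros of \<open>(s)\<^sub>n\<close>.
\<close>

lemma G_tilde_minus_G_hat_eq_residues:
  fixes a b :: "complex ^ 'p"
  assumes a: "\<And>i. - (a $ i) \<notin> \<nat>" and x: "0 < x" "x < 1"
  shows "G_tilde a b n x - (-1) ^ n * G_hat a b n x =
    (\<Sum>m<n. residue (meijer_kernel a b n x) (- of_nat m))"
proof -
  define H where "H = meijer_kernel a b n x"
  define F where "F = remove_sings H"
  define S where "S = {z. is_pole H z}"
  define A where "A = numerator_poles a n"
  obtain M where decay: "left_decaying F S ((1 + x) / 2) M"
    using kernel_left_decaying[OF x, of a b n] unfolding F_def H_def S_def by blast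
  interpret left_decaying F S "(1 + x) / 2" M
    by (rule decay)
  have S_sub: "z \<in> A \<or> z \<in> denominator_zeros n" if "z \<in> S" for z
    using is_pole_kernel_imp[OF x(1)] that by (auto simp: S_def H_def A_def)
  have "countable S"
    using sparse_imp_countable[OF open_UNIV sparse_S] by simp
  \<comment> \<open>all vertical lines at \<open>T\<^sub>0 - k\<close> must avoid the poles\<close>
  then have "countable (\<Union>k. (\<lambda>z. Re z + real k) ` S)"
    by auto
  then have "{M - 1<..<M} - (\<Union>k. (\<lambda>z. Re z + real k) ` S) \<noteq> {}"
    using uncountable_open_interval[of "M - 1" M] uncountable_minus_countable
    by (metis countable_empty diff_strict_left_mono diff_zero zero_less_one)
  then obtain T0 where "T0 < M" "T0 \<notin> (\<Union>k. (\<lambda>z. Re z + real k) ` S)"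
    unfolding ex_in_conv[symmetric] by auto
  have T0: "T0 \<le> M" "\<And>k z. z \<in> S \<Longrightarrow> Re z \<noteq> T0 - real k"
  proof -
    fix k z assume "z \<in> S"
    then show "Re z \<noteq> T0 - real k"
      using \<open>T0 \<notin> _\<close> by (force simp: algebra_simps)
  qed (use \<open>T0 < M\<close> in simp)
  define R where "R L k = 2 * of_real pi * \<i> * (\<Sum>p | p \<in> S \<inter> L \<and> T0 - real k < Re p. residue F p)"
    for L k
  \<comment> \<open>outside this countable set all the functions involved agree up to the sign\<close>
  define D where "D = \<int> \<union> A \<union> denominator_zeros n"
  have D: "countable D"
    using sparse_imp_countable[OF open_UNIV numerator_poles_sparse[of a n]]
      sparse_imp_countable[OF open_UNIV Ints_sparse] finite_denominator_zeros[of n]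
    by (simp add: D_def A_def countable_finite)
  have F_eq: "F z = H z" if "z \<notin> D" for z
    using kernel_analytic_at[OF x(1), of z a n b] that by (simp add: F_def D_def A_def H_def)

  have tilde: "\<exists>I. has_left_loop_integral F I g \<and> R UNIV \<longlonglongrightarrow> I" if "G_tilde_loop a b n x g" for g
  proof -
    have left: "on_left_of_loop g z" if "z \<in> S" for z
      using \<open>G_tilde_loop a b n x g\<close> that
      by (auto simp: G_tilde_loop_def is_pole_G_tilde_integrand_iff S_def H_def)
    have loop: "left_loop_image g \<inter> S = {}" "left_loop g"
      using left that by (auto simp: on_left_of_loop_def G_tilde_loop_def)
    show ?thesis
    proof (rule left_loop_integral_eq_residues[of g T0 UNIV])
      fix I assume I: "has_left_loop_integral F I g"
        "(\<lambda>k. 2 * of_real pi * \<i> * (\<Sum>p | p \<in> S \<inter> UNIV \<and> T0 - real k < Re p. residue F p)) \<longlonglongrightarrow> I"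
      show "\<exists>I. has_left_loop_integral F I g \<and> R UNIV \<longlonglongrightarrow> I"
        using I by (intro exI[of _ I] conjI) (simp_all only: R_def[abs_def])
    qed (use loop T0 left in auto)
  qed
  have hat: "\<exists>I. has_left_loop_integral F I g \<and> R A \<longlonglongrightarrow> I" if "G_hat_loop a n g" for g
  proof -
    have left: "on_left_of_loop g z" if "z \<in> A" for z
      using \<open>G_hat_loop a n g\<close> that by (auto simp: G_hat_loop_def A_def numerator_poles_def)
    have right: "on_right_of_loop g z" if "z \<in> denominator_zeros n" for z
      using \<open>G_hat_loop a n g\<close> denominator_zeros_subset[OF that] by (auto simp: G_hat_loop_def)
    have right': "on_right_of_loop g z" if "z \<in> S" "z \<notin> A" for z
      using S_sub[OF that(1)] that(2) right by blast
    have loop: "left_loop_image g \<inter> S = {}" "left_loop g"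
      using left right S_sub that
      by (auto simp: on_left_of_loop_def on_right_of_loop_def G_hat_loop_def)
    show ?thesis
    proof (rule left_loop_integral_eq_residues[of g T0 A])
      fix I assume I: "has_left_loop_integral F I g"
        "(\<lambda>k. 2 * of_real pi * \<i> * (\<Sum>p | p \<in> S \<inter> A \<and> T0 - real k < Re p. residue F p)) \<longlonglongrightarrow> I"
      show "\<exists>I. has_left_loop_integral F I g \<and> R A \<longlonglongrightarrow> I"
        using I by (intro exI[of _ I] conjI) (simp_all only: R_def[abs_def])
    qed (use loop T0 left right' in auto)
  qed
  obtain gt where "G_tilde_loop a b n x gt"
    using G_tilde_loop_exists[OF x(1)] by blast
  then obtain It where It: "R UNIV \<longlonglongrightarrow> It"
    using tilde by blast
  obtain gh where "G_hat_loop a n gh"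
    using G_hat_loop_exists[OF a] by blast
  then obtain Ih where Ih: "R A \<longlonglongrightarrow> Ih"
    using hat by blast

  have "G_tilde a b n x = It / (2 * of_real pi * \<i>)"
    unfolding G_tilde_def
  proof (rule common_loop_integral_value[OF G_tilde_loop_exists[OF x(1)]])
    fix g assume g: "G_tilde_loop a b n x g"
    obtain I where I: "has_left_loop_integral F I g" "R UNIV \<longlonglongrightarrow> I"
      using tilde[OF g] by blast
    have "I = It"
      by (rule LIMSEQ_unique[OF I(2) It])
    have eq: "G_tilde_integrand a b n x z = F z" if "z \<notin> D" for z
      using that F_eq[OF that] by (simp add: D_def H_def G_tilde_integrand_eq_kernel)
    have "valid_path g"
      using g by (simp add: G_tilde_loop_def left_loop_def)
    then have "has_left_loop_integral (G_tilde_integrand a b n x) I g"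
      by (rule has_left_loop_integral_spike_countable[OF I(1) _ D]) (rule eq)
    then show "has_left_loop_integral (G_tilde_integrand a b n x) It g"
      unfolding \<open>I = It\<close> .
  qed
  moreover have "G_hat a b n x = (-1) ^ n * Ih / (2 * of_real pi * \<i>)"
    unfolding G_hat_def
  proof (rule common_loop_integral_value[OF G_hat_loop_exists[OF a]])
    fix g assume g: "G_hat_loop a n g"
    obtain I where I: "has_left_loop_integral F I g" "R A \<longlonglongrightarrow> I"
      using hat[OF g] by blast
    have "I = Ih"
      by (rule LIMSEQ_unique[OF I(2) Ih])
    have eq: "G_hat_integrand a b n x z = (-1) ^ n * F z" if "z \<notin> D" for z
      using that F_eq[OF that] by (simp add: D_def H_def G_hat_integrand_eq_kernel)
    have "valid_path g"
      using g by (simp add: G_hat_loop_def left_loop_def)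
    then have "has_left_loop_integral (G_hat_integrand a b n x) ((-1) ^ n * I) g"
      by (rule has_left_loop_integral_spike_countable[OF has_left_loop_integral_cmult[OF I(1)] _ D])
        (rule eq)
    then show "has_left_loop_integral (G_hat_integrand a b n x) ((-1) ^ n * Ih) g"
      unfolding \<open>I = Ih\<close> .
  qed
  ultimately have diff: "G_tilde a b n x - (-1) ^ n * G_hat a b n x = (It - Ih) / (2 * of_real pi * \<i>)"
    by (cases "even n") (simp_all add: diff_divide_distrib)

  have sum_residues: "(\<Sum>p\<in>S \<inter> denominator_zeros n. residue F p) = (\<Sum>m<n. residue H (- of_nat m))"
  proof -
    have "(\<Sum>p\<in>S \<inter> denominator_zeros n. residue F p) = (\<Sum>p\<in>denominator_zeros n. residue F p)"
    proof (rule sum.mono_neutral_left)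
      \<comment> \<open>a zero of \<open>(s)\<^sub>n\<close> is no pole if it is cancelled by a pole of \<open>\<Gamma>(b + n - 1 + s)\<close>\<close>
      show "\<forall>p\<in>denominator_zeros n - S \<inter> denominator_zeros n. residue F p = 0"
        using residue_holo[OF open_compl_S _ holo] by auto
    qed (auto intro: finite_denominator_zeros)
    also have "\<dots> = (\<Sum>m<n. residue F (- of_nat m))"
      unfolding denominator_zeros_def by (subst sum.reindex) (auto intro: inj_onI)
    also have "\<dots> = (\<Sum>m<n. residue H (- of_nat m))"
      unfolding F_def H_def
      by (intro sum.cong refl residue_remove_sings kernel_isolated_singularity[OF x(1)])
    finally show ?thesis .
  qed
  have lim: "(\<lambda>k. R UNIV k - R A k) \<longlonglongrightarrow> It - Ih"
    by (rule tendsto_diff[OF It Ih])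
  have ev: "\<forall>\<^sub>F k in sequentially. R UNIV k - R A k =
      2 * of_real pi * \<i> * (\<Sum>m<n. residue H (- of_nat m))"
  proof -
    have "\<forall>\<^sub>F k in sequentially. T0 - real k < - real n"
      by real_asymp
    then show ?thesis
    proof eventually_elim
      case (elim k)
      have fin: "finite {p. p \<in> S \<inter> A \<and> T0 - real k < Re p}"
        by (rule finite_subset[OF _ finite_right[of "T0 - real k"]]) auto
      have AZ: "p \<notin> A" if "p \<in> denominator_zeros n" for p
        using denominator_zeros_subset[OF that] numerator_poles_disjoint[OF a] by (auto simp: A_def)
      have "{p. p \<in> S \<inter> UNIV \<and> T0 - real k < Re p} =
          {p. p \<in> S \<inter> A \<and> T0 - real k < Re p} \<union> (S \<inter> denominator_zeros n)"
        using S_sub elim by (auto simp: denominator_zeros_def)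
      then have "(\<Sum>p | p \<in> S \<inter> UNIV \<and> T0 - real k < Re p. residue F p) =
          (\<Sum>p\<in>{p. p \<in> S \<inter> A \<and> T0 - real k < Re p} \<union> (S \<inter> denominator_zeros n). residue F p)"
        by (rule arg_cong)
      also have "\<dots> = (\<Sum>p | p \<in> S \<inter> A \<and> T0 - real k < Re p. residue F p) +
          (\<Sum>p\<in>S \<inter> denominator_zeros n. residue F p)"
        using AZ by (intro sum.union_disjoint fin finite_Int disjI2 finite_denominator_zeros) auto
      finally show ?case
        unfolding R_def sum_residues by (simp add: ring_distribs)
    qed
  qed
  have "It - Ih = 2 * of_real pi * \<i> * (\<Sum>m<n. residue H (- of_nat m))"
    by (rule LIMSEQ_unique[OF lim tendsto_eventually[OF ev]])
  then show ?thesis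
    unfolding diff by (simp add: H_def)
qed

section \<open>Evaluation of the residues\<close>

lemma pochhammer_minus_nat:
  "pochhammer (- of_nat (m + j) :: 'a::field_char_0) j = (-1) ^ j * fact (m + j) / fact m"
proof -
  have "(fact (m + j) :: 'a) = fact m * pochhammer (1 + of_nat m) j"
    unfolding pochhammer_fact by (rule pochhammer_product')
  moreover have "of_nat (m + j) - of_nat j + 1 = (1 + of_nat m :: 'a)"
    by simp
  ultimately show ?thesis
    by (simp only: pochhammer_minus) simp
qed

text \<open>
  The left-hand side is the residue of the kernel at \<open>j + 1 - n\<close>.
\<close>

lemma hypergeometric_quotient_term:
  fixes a b :: "complex ^ 'p"
  assumes a: "\<And>i. - (a $ i) \<notin> \<nat>" and "x \<noteq> 0" "j < n"
  shows "(\<Prod>i\<in>UNIV. Gamma (a $ i + of_nat j) * rGamma (b $ i + of_nat j)) *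
      (- of_real x) ^ (n - Suc j) / (fact (n - Suc j) * fact j) =
    (- of_real x) ^ (n - 1) * Gamma_vec a / fact (n - 1) *
      (pochhammer (1 - of_nat n) j * pochhammer_vec a j /
       (Gamma_vec (shift_vec b (of_nat j)) * fact j) * (1 / of_real x) ^ j)"
proof -
  obtain m where n: "n = Suc (m + j)"
    using \<open>j < n\<close> by (metis add.commute less_iff_Suc_add)
  have "Gamma (a $ i + of_nat j) = Gamma (a $ i) * pochhammer (a $ i) j" for i
  proof -
    have "a $ i \<notin> \<int>\<^sub>\<le>\<^sub>0"
      using a[of i] by (auto elim!: nonpos_Ints_cases')
    then show ?thesis
      by (simp add: pochhammer_Gamma Gamma_eq_zero_iff)
  qed
  then have P: "(\<Prod>i\<in>UNIV. Gamma (a $ i + of_nat j) * rGamma (b $ i + of_nat j)) =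
      Gamma_vec a * pochhammer_vec a j / Gamma_vec (shift_vec b (of_nat j))"
    by (simp add: Gamma_vec_def pochhammer_vec_def shift_vec_def rGamma_inverse_Gamma
        prod_dividef[symmetric] prod.distrib[symmetric] divide_inverse[symmetric])
  have powers: "(- of_real x) ^ (n - 1) = (- of_real x :: complex) ^ m * ((-1) ^ j * of_real x ^ j)"
    by (simp add: n power_add flip: power_mult_distrib)
  have poch: "pochhammer (1 - of_nat n :: complex) j = (-1) ^ j * fact (n - 1) / fact m"
    using pochhammer_minus_nat[of m j] n by simp
  have sign: "(-1) ^ j * (-1) ^ j = (1 :: complex)" and inv: "of_real x ^ j * (1 / of_real x) ^ j = (1 :: complex)"
    using \<open>x \<noteq> 0\<close> by (simp_all flip: power_mult_distrib)
  have m: "n - Suc j = m"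
    using n by simp
  have algebra: "G * P / B * X / (f' * j') = X * (e * y) * G / f * (e * f / f' * P / (B * j') * z)"
    if "e * e = 1" "y * z = 1" "f \<noteq> 0" for G P B X f f' j' e y z :: complex
  proof -
    have "X * (e * y) * G / f * (e * f / f' * P / (B * j') * z) =
        (e * e) * (y * z) * (G * P / B * X / (f' * j'))"
      using \<open>f \<noteq> 0\<close> by (simp add: divide_inverse mult_ac)
    then show ?thesis
      using that by simp
  qed
  show ?thesis
    unfolding P powers poch m by (rule algebra[OF sign inv]) simp
qed

theorem proposition1:
  fixes a b :: "complex ^ 'p" and n :: nat and x :: real
  assumes "\<And>i. - (a $ i) \<notin> \<nat>"
    and "0 < x" and "x < 1"
  shows "G_tilde a b n x - (-1) ^ n * G_hat a b n x =
    (if n = 0 then 0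
     else (- of_real x) ^ (n - 1) * Gamma_vec a / fact (n - 1) *
          hypergeometric_quotient a b n (1 / of_real x))"
proof -
  have "G_tilde a b n x - (-1) ^ n * G_hat a b n x =
      (\<Sum>m<n. residue (meijer_kernel a b n x) (- of_nat m))"
    by (rule G_tilde_minus_G_hat_eq_residues[OF assms])
  also have "\<dots> = (\<Sum>j<n. residue (meijer_kernel a b n x) (- of_nat (n - Suc j)))"
    by (rule sum.nat_diff_reindex[symmetric])
  also have "\<dots> = (\<Sum>j<n. (- of_real x) ^ (n - 1) * Gamma_vec a / fact (n - 1) *
      (pochhammer (1 - of_nat n) j * pochhammer_vec a j /
       (Gamma_vec (shift_vec b (of_nat j)) * fact j) * (1 / of_real x) ^ j))"
  proof (rule sum.cong)
    fix j assume "j \<in> {..<n}"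
    then have j: "j < n" and sub: "n - 1 - (n - Suc j) = j"
      by auto
    have "- of_nat (n - Suc j) = (1 - of_nat n + of_nat j :: complex)"
      using j by (simp add: of_nat_diff)
    then have "- of_nat (n - Suc j) \<notin> numerator_poles a n"
      using numerator_poles_disjoint[OF assms(1), of n j] by metis
    then have "residue (meijer_kernel a b n x) (- of_nat (n - Suc j)) =
        (\<Prod>i\<in>UNIV. Gamma (a $ i + of_nat j) * rGamma (b $ i + of_nat j)) *
        (- of_real x) ^ (n - Suc j) / (fact (n - Suc j) * fact j)"
      using residue_kernel[OF assms(2), of "n - Suc j" n a b] j unfolding sub by simp
    then show "residue (meijer_kernel a b n x) (- of_nat (n - Suc j)) =
        (- of_real x) ^ (n - 1) * Gamma_vec a / fact (n - 1) *
        (pochhammer (1 - of_nat n) j * pochhammer_vec a j /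
         (Gamma_vec (shift_vec b (of_nat j)) * fact j) * (1 / of_real x) ^ j)"
      using hypergeometric_quotient_term[OF assms(1) _ j, of x b] assms(2) by simp
  qed simp
  also have "\<dots> = (- of_real x) ^ (n - 1) * Gamma_vec a / fact (n - 1) *
      hypergeometric_quotient a b n (1 / of_real x)"
    by (simp only: hypergeometric_quotient_def sum_distrib_left)
  finally show ?thesis
    by (simp add: hypergeometric_quotient_def)
qed

end
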